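(* Let $d\ge2$, let $\Phi\in\mathcal T_E(\Sigma_d)$ be a non-degenerate essentially affine iterated function system, and let $(u,v,p)$ be a $\Phi$-admissible triple, i.e. $u,v,p\in\mathbb R$, $v\ne0$, and $$P_\Phi\Big(\frac uv\Big)<\frac{P_\Phi(u)-p}{v}.$$ Then there exists $[\Psi]\in\mathcal T_E(\Sigma_d)/\sim$, which is unique up to permutations of the generators of $\Psi$, such that $$\mu_{\Phi,u}\cong\mu_{\Psi,v}\quad\text{and}\quad p=P_\Psi(v).$$
   Context: Let $I=\{1,\dots,d\}$, $d\ge2$, $\Sigma_d=I^{\mathbb N}$ with left shift $\sigma$, $[x_1\dots x_n]$ the cylinder of all $y\in\Sigma_d$ with $y_i=x_i$ for $i\le n$, and $S_nf=\sum_{k=0}^{n-1}f\circ\sigma^k$. Conformal iterated function system (CS). An ordered family $\Phi=(\phi_i:X\to\operatorname{Int}X\mid i\in I)$ of injective contractions of a connected compact set (interval) $X\subset\mathbb R$, such that, writing $\phi_\omega=\phi_{x_1}\circ\dots\circ\phi_{x_n}$ for $\omega=x_1\dots x_n\in I^n$: - (open set condition) $\phi_i(\operatorname{Int}X)\subset\operatorname{Int}X$ for all $i$, and $\phi_i(\operatorname{Int}X)\cap\phi_j(\operatorname{Int}X)=\emptyset$ for $i\ne j$; - (conformality) there is an open connected set $U\subset\mathbb C$ containing $X$ such that each $\phi_i$ extends to a conformal map on $U$ (into $U$, so that the $\phi_\omega$ are defined on $U$); - (bounded distortion) there is $C\ge1$ with $|\phi_\omega'(y)|\le C|\phi_\omega'(x)|$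 for all $n\in\mathbb N$, $\omega\in I^n$, $x,y\in U$. The limit set is $\Lambda(\Phi)=\bigcap_n\bigcup_{\omega\in I^n}\phi_\omega(X)$, and $\pi_\Phi:\Sigma_d\to\Lambda(\Phi)$, $\pi_\Phi(x_1x_2\dots)=\lim_n\phi_{x_1\dots x_n}(X)$, is the canonical bijection. $\mathcal T(\Sigma_d)$ is the set of all CS with index set $I$. For $\Phi,\Psi\in\mathcal T(\Sigma_d)$, $\Phi\sim\Psi$ means that there is a bi-Lipschitz bijection $h:\Lambda(\Phi)\to\Lambda(\Psi)$ with $\psi_i=h\circ\phi_i\circ h^{-1}$ on $\Lambda(\Psi)$ for all $i\in I$. A CS is an affine system (AS) if all its generators are affine; it is an essentially affine system (EAS) if it is $\sim$-equivalent to an AS. $\mathcal T_E(\Sigma_d)$ is the set of all EAS in $\mathcal T(\Sigma_d)$, and $[\Psi]$ denotes the $\sim$-class of $\Psi$. A CS is degenerate if it is $\sim$-equivalent to an AS $(\psi_i)_{i\in I}$ with $\psi_i'=\psi_j'$ for all $i,j\in I$. The canonical geometric potential is $I_\Phi:\Sigma_d\to\mathbb R$, $I_\Phi(x)=\log|\phi_{x_1}'(\pi_\Phi(\sigma x))|$. The pressure of $f:\Sigma_d\to\mathbb R$ is $\mathcal P(f)=\lim_n\frac1n\log\sum_{\omega\in I^n}\exp(\sup_{x\in[\omega]}S_nf(x))$, and $P_\Phi(u):=\mathcal P(u I_\Phi)$ for $u\in\mathbb R$. $\mu_{\Phi,u}$ is the $\sigma$-invariant Gibbs probability measure on $\Sigma_d$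 for $uI_\Phi-P_\Phi(u)$, i.e. the $\sigma$-invariant probability measure with $\mu_{\Phi,u}([x_1\dots x_n])\asymp e^{uS_nI_\Phi(x)-nP_\Phi(u)}$ uniformly in $n$, $(x_1,\dots,x_n)\in I^n$ and $x\in[x_1\dots x_n]$. Both $\mu_{\Phi,u}$ and $P_\Phi$ depend only on the $\sim$-class of $\Phi$. $\mu_{\Phi,u}\cong\mu_{\Psi,v}$ means $\mu_{\Phi,u}=\mu_{\Psi_0,v}$ for some system $\Psi_0=(\psi_{\tau(1)},\dots,\psi_{\tau(d)})$ obtained from $\Psi$ by a permutation $\tau$ of its generators. *)

theory Defs
  imports "HOL-Probability.Probability"
begin

text \<open>
  The shift space over \<open>{1..d}\<close> is \<open>streams {1..d}\<close> with left shift \<open>stl\<close>; \<open>sdrop k\<close> is its \<open>k\<close>-th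
  iterate and \<open>sstart {1..d} \<omega>\<close> is the cylinder of all sequences over \<open>{1..d}\<close> with prefix \<open>\<omega>\<close>.
\<close>

definition words :: "nat \<Rightarrow> nat \<Rightarrow> nat list set" where
  "words d n = {\<omega> \<in> lists {1..d}. length \<omega> = n}"

definition birkhoff_sum :: "(nat stream \<Rightarrow> real) \<Rightarrow> nat \<Rightarrow> nat stream \<Rightarrow> real" where
  "birkhoff_sum f n x = (\<Sum>k<n. f (sdrop k x))"

definition pressure :: "nat \<Rightarrow> (nat stream \<Rightarrow> real) \<Rightarrow> real" where
  "pressure d f =
     lim (\<lambda>n. ln (\<Sum>\<omega>\<in>words d n. exp (SUP x\<in>sstart {1..d} \<omega>. birkhoff_sum f n x)) / real n)"

text \<open>
  Only the values of \<open>gen \<Phi> i\<close> on \<open>dom \<Phi>\<close> for \<open>i \<in> {1..d}\<close> are meaningful; all other values are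
  arbitrary and none of the notions below depends on them.  For a word
  \<open>\<omega> = [x\<^sub>1, \<dots>, x\<^sub>n]\<close>, the term \<open>foldr (gen \<Phi>) \<omega>\<close> is the composition
  \<open>gen \<Phi> x\<^sub>1 \<circ> \<dots> \<circ> gen \<Phi> x\<^sub>n\<close>.
\<close>

record ifs =
  dom :: "real set"
  gen :: "nat \<Rightarrow> real \<Rightarrow> real"

text \<open>
  The complex extension \<open>F i\<close> of \<open>gen \<Phi> i\<close> is conformal in the sense of being holomorphic with
  nowhere vanishing derivative.
\<close>

definition conformal_bounded_distortion :: "nat \<Rightarrow> ifs \<Rightarrow> bool" where
  "conformal_bounded_distortion d \<Phi> \<longleftrightarrow>
     (\<exists>U F. open U \<and> connected U \<and> complex_of_real ` dom \<Phi> \<subseteq> U \<and>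
        (\<forall>i\<in>{1..d}. F i holomorphic_on U \<and> (\<forall>z\<in>U. deriv (F i) z \<noteq> 0) \<and> F i ` U \<subseteq> U \<and>
           (\<forall>x\<in>dom \<Phi>. F i (complex_of_real x) = complex_of_real (gen \<Phi> i x))) \<and>
        (\<exists>C\<ge>1. \<forall>\<omega>\<in>lists {1..d}. \<forall>x\<in>U. \<forall>y\<in>U.
           cmod (deriv (foldr F \<omega>) y) \<le> C * cmod (deriv (foldr F \<omega>) x)))"

definition CS :: "nat \<Rightarrow> ifs set" where
  "CS d = {\<Phi>.
     dom \<Phi> \<noteq> {} \<and> connected (dom \<Phi>) \<and> compact (dom \<Phi>) \<and>
     (\<forall>i\<in>{1..d}. gen \<Phi> i ` dom \<Phi> \<subseteq> interior (dom \<Phi>) \<and> inj_on (gen \<Phi> i) (dom \<Phi>) \<and>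
        (\<exists>c<1. c-lipschitz_on (dom \<Phi>) (gen \<Phi> i))) \<and>
     (\<forall>i\<in>{1..d}. gen \<Phi> i ` interior (dom \<Phi>) \<subseteq> interior (dom \<Phi>)) \<and>
     (\<forall>i\<in>{1..d}. \<forall>j\<in>{1..d}. i \<noteq> j \<longrightarrow>
        gen \<Phi> i ` interior (dom \<Phi>) \<inter> gen \<Phi> j ` interior (dom \<Phi>) = {}) \<and>
     conformal_bounded_distortion d \<Phi>}"

definition limit_set :: "nat \<Rightarrow> ifs \<Rightarrow> real set" where
  "limit_set d \<Phi> = (\<Inter>n. \<Union>\<omega>\<in>words d n. foldr (gen \<Phi>) \<omega> ` dom \<Phi>)"

text \<open>
  The sets \<open>foldr (gen \<Phi>) (stake n x) ` dom \<Phi>\<close> decrease with \<open>n\<close> and their diameters tend to \<open>0\<close>;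
  their limit is the unique point of their intersection.
\<close>

definition coding_map :: "ifs \<Rightarrow> nat stream \<Rightarrow> real" where
  "coding_map \<Phi> x = (THE y. (\<Inter>n. foldr (gen \<Phi>) (stake n x) ` dom \<Phi>) = {y})"

definition cs_equiv :: "nat \<Rightarrow> (ifs \<times> ifs) set" where
  "cs_equiv d = {(\<Phi>, \<Psi>). \<Phi> \<in> CS d \<and> \<Psi> \<in> CS d \<and>
     (\<exists>h. bij_betw h (limit_set d \<Phi>) (limit_set d \<Psi>) \<and>
        (\<exists>L. L-lipschitz_on (limit_set d \<Phi>) h) \<and>
        (\<exists>L. L-lipschitz_on (limit_set d \<Psi>) (inv_into (limit_set d \<Phi>) h)) \<and>
        (\<forall>i\<in>{1..d}. \<forall>y\<in>limit_set d \<Psi>.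
           gen \<Psi> i y = h (gen \<Phi> i (inv_into (limit_set d \<Phi>) h y))))}"

definition AS :: "nat \<Rightarrow> ifs set" where
  "AS d = {\<Phi> \<in> CS d. \<forall>i\<in>{1..d}. \<exists>a b. \<forall>x\<in>dom \<Phi>. gen \<Phi> i x = a * x + b}"

definition EAS :: "nat \<Rightarrow> ifs set" where
  "EAS d = {\<Phi> \<in> CS d. \<exists>\<Psi>\<in>AS d. (\<Phi>, \<Psi>) \<in> cs_equiv d}"

definition degenerate :: "nat \<Rightarrow> ifs \<Rightarrow> bool" where
  "degenerate d \<Phi> \<longleftrightarrow> (\<exists>\<Psi>\<in>AS d. (\<Phi>, \<Psi>) \<in> cs_equiv d \<and>
     (\<forall>i\<in>{1..d}. \<forall>j\<in>{1..d}. \<forall>x\<in>interior (dom \<Psi>). deriv (gen \<Psi> i) x = deriv (gen \<Psi> j) x))"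

text \<open>
  The limit set lies in the interior of \<open>dom \<Phi>\<close>, so the derivative below is that of the generator
  as a map on \<open>dom \<Phi>\<close>.
\<close>

definition geometric_potential :: "ifs \<Rightarrow> nat stream \<Rightarrow> real" where
  "geometric_potential \<Phi> x = ln \<bar>deriv (gen \<Phi> (shd x)) (coding_map \<Phi> (stl x))\<bar>"

definition ifs_pressure :: "nat \<Rightarrow> ifs \<Rightarrow> real \<Rightarrow> real" where
  "ifs_pressure d \<Phi> u = pressure d (\<lambda>x. u * geometric_potential \<Phi> x)"

definition is_gibbs :: "nat \<Rightarrow> ifs \<Rightarrow> real \<Rightarrow> nat stream measure \<Rightarrow> bool" where
  "is_gibbs d \<Phi> u M \<longleftrightarrow>
     prob_space M \<and> sets M = sets (stream_space (count_space {1..d})) \<and> distr M M stl = M \<and>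
     (\<exists>C\<ge>1. \<forall>n. \<forall>\<omega>\<in>words d n. \<forall>x\<in>sstart {1..d} \<omega>.
        (let w = exp (u * birkhoff_sum (geometric_potential \<Phi>) n x - real n * ifs_pressure d \<Phi> u)
         in w / C \<le> measure M (sstart {1..d} \<omega>) \<and> measure M (sstart {1..d} \<omega>) \<le> C * w))"

definition gibbs_measure :: "nat \<Rightarrow> ifs \<Rightarrow> real \<Rightarrow> nat stream measure" where
  "gibbs_measure d \<Phi> u = (THE M. is_gibbs d \<Phi> u M)"

definition permute_gens :: "(nat \<Rightarrow> nat) \<Rightarrow> ifs \<Rightarrow> ifs" where
  "permute_gens \<tau> \<Psi> = \<Psi>\<lparr>gen := \<lambda>i. gen \<Psi> (\<tau> i)\<rparr>"

definition gibbs_iso :: "nat \<Rightarrow> ifs \<Rightarrow> real \<Rightarrow> ifs \<Rightarrow> real \<Rightarrow> bool" where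
  "gibbs_iso d \<Phi> u \<Psi> v \<longleftrightarrow>
     (\<exists>\<tau>. \<tau> permutes {1..d} \<and> gibbs_measure d \<Phi> u = gibbs_measure d (permute_gens \<tau> \<Psi>) v)"

definition admissible :: "nat \<Rightarrow> ifs \<Rightarrow> real \<Rightarrow> real \<Rightarrow> real \<Rightarrow> bool" where
  "admissible d \<Phi> u v p \<longleftrightarrow>
     v \<noteq> 0 \<and> ifs_pressure d \<Phi> (u / v) < (ifs_pressure d \<Phi> u - p) / v"

end

theory Submission
  imports Defs
begin

text \<open>
  An essentially affine system \<open>\<Phi>\<close> is conjugate to an affine one with slopes \<open>a\<^sub>1, \<dots>, a\<^sub>d\<close>, and all that
  pressure and Gibbs measures see of \<open>\<Phi>\<close> are the contraction ratios \<open>r\<^sub>i = \<bar>a\<^sub>i\<bar>\<close>.  Indeed, by the chain rule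
  \<open>exp (S\<^sub>n I\<^sub>\<Phi> x)\<close> is a value of \<open>\<bar>\<phi>\<^sub>\<omega>'\<bar>\<close> for the prefix \<open>\<omega>\<close> of length \<open>n\<close> of \<open>x\<close>.  Bounded distortion and the
  mean value theorem compare it with \<open>\<bar>\<phi>\<^sub>\<omega> \<xi> - \<phi>\<^sub>\<omega> \<eta>\<bar>\<close> for two points \<open>\<xi> \<noteq> \<eta>\<close> of the limit set, chosen once and
  for all; a bi-Lipschitz conjugacy turns that into a distance in the affine system, and there it is exactly the product of the
  \<open>r\<^sub>i\<close> along \<open>\<omega>\<close> times a constant (\<open>birkhoff_sum_comparable\<close>, \<open>has_ratios_of_equiv_affine\<close>).

  With Birkhoff sums known up to a bounded error, \<open>P\<^sub>\<Phi> u = ln (\<Sum>i. r\<^sub>i powr u)\<close>, and a Gibbs measure is a shift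
  invariant probability measure comparable on cylinders with the Bernoulli measure of weights \<open>r\<^sub>i powr u / exp (P\<^sub>\<Phi> u)\<close>.
  Such a measure equals that Bernoulli measure (\<open>ifs_pressure_eq\<close>, \<open>is_gibbs_iff_bernoulli\<close>): Bernoulli
  measures obey the weak law of large numbers with a variance bound, a comparable invariant measure
  inherits the bound, and hence both give the same mass to every cylinder (\<open>bounded_invariant_weights_eq\<close>).

  So the two requirements on \<open>\<Psi>\<close> say precisely that its ratios are, up to order,
  \<open>s\<^sub>i = (w\<^sub>i * exp p) powr (1 / v)\<close>, where the \<open>w\<^sub>i\<close> are the weights of the Gibbs measure of \<open>\<Phi>\<close>.  Summing gives
  \<open>(\<Sum>i. s\<^sub>i) = exp (P\<^sub>\<Phi> (u / v) - (P\<^sub>\<Phi> u - p) / v)\<close>, so admissibility means \<open>(\<Sum>i. s\<^sub>i) < 1\<close>.  This is the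
  condition under which intervals of lengths \<open>s\<^sub>i\<close> fit disjointly into the interior of \<open>[0, 1]\<close>, which gives an
  affine system with these ratios (\<open>affine_system_exists\<close>).  For uniqueness, the coding maps of two affine
  systems with the same ratios have comparable increments, since the distance of two coded points is the
  weight of their common prefix up to a constant; matching codes is then a bi-Lipschitz conjugacy,
  whatever the signs of the slopes and the order of the intervals (\<open>affine_equal_ratios_equiv\<close>).
\<close>

section \<open>Words over a finite alphabet\<close>

text \<open>
  The alphabet appears as \<open>{1..d}\<close> throughout; rewriting \<open>1\<close> to \<open>Suc 0\<close> would break this common form.
\<close>

declare One_nat_def [simp del]

abbreviation weight :: "(nat \<Rightarrow> real) \<Rightarrow> nat list \<Rightarrow> real" where
  "weight r \<omega> \<equiv> prod_list (map r \<omega>)"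

lemma words_0 [simp]: "words d 0 = {[]}"
  by (auto simp: words_def)

lemma words_add: "words d (m + n) = (\<lambda>(\<beta>, \<omega>). \<beta> @ \<omega>) ` (words d m \<times> words d n)"
proof (intro equalityI subsetI)
  fix \<omega> assume w: "\<omega> \<in> words d (m + n)"
  have "\<omega> = take m \<omega> @ drop m \<omega>" by simp
  moreover have "take m \<omega> \<in> words d m" "drop m \<omega> \<in> words d n"
    using w by (auto simp: words_def dest: in_set_takeD in_set_dropD)
  ultimately show "\<omega> \<in> (\<lambda>(\<beta>, \<omega>). \<beta> @ \<omega>) ` (words d m \<times> words d n)"
    by (metis (mono_tags, lifting) SigmaI case_prod_conv image_eqI)
qed (auto simp: words_def)

lemma words_1: "words d (Suc 0) = (\<lambda>i. [i]) ` {1..d}"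
  by (auto simp: words_def length_Suc_conv)

lemma finite_words [simp]: "finite (words d n)"
  by (rule finite_subset[OF _ finite_lists_length_eq[of "{1..d}" n]]) (auto simp: words_def)

lemma words_in_lists: "\<omega> \<in> words d n \<Longrightarrow> \<omega> \<in> lists {1..d}"
  by (simp add: words_def)

lemma sum_words_add:
  fixes f :: "nat list \<Rightarrow> 'a::comm_monoid_add"
  shows "(\<Sum>\<omega>\<in>words d (m + n). f \<omega>) = (\<Sum>\<beta>\<in>words d m. \<Sum>\<omega>\<in>words d n. f (\<beta> @ \<omega>))"
proof -
  have "inj_on (\<lambda>(\<beta>, \<omega>). \<beta> @ \<omega>) (words d m \<times> words d n)"
    by (auto simp: inj_on_def words_def)
  then show ?thesis
    unfolding words_add by (subst sum.reindex) (auto simp: sum.cartesian_product case_prod_unfold)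
qed

lemma sum_words_1:
  fixes f :: "nat list \<Rightarrow> 'a::comm_monoid_add"
  shows "(\<Sum>\<omega>\<in>words d (Suc 0). f \<omega>) = (\<Sum>i=1..d. f [i])"
  unfolding words_1 by (subst sum.reindex) (auto simp: inj_on_def)

lemma sum_weight_words: "(\<Sum>\<omega>\<in>words d n. weight r \<omega>) = (\<Sum>i=1..d. r i) ^ n"
proof (induction n)
  case (Suc n)
  have "(\<Sum>\<omega>\<in>words d (Suc 0 + n). weight r \<omega>) = (\<Sum>i=1..d. \<Sum>\<omega>\<in>words d n. r i * weight r \<omega>)"
    by (simp only: sum_words_add sum_words_1) simp
  also have "\<dots> = (\<Sum>i=1..d. r i) * (\<Sum>i=1..d. r i) ^ n"
    by (simp only: sum_distrib_left[symmetric] sum_distrib_right[symmetric] Suc.IH)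
  finally show ?case by simp
qed simp

lemma weight_nonneg:
  "(\<And>i. i \<in> {1..d} \<Longrightarrow> 0 \<le> r i) \<Longrightarrow> \<omega> \<in> lists {1..d} \<Longrightarrow> 0 \<le> weight r \<omega>"
  by (induction \<omega>) auto

lemma weight_pos:
  "(\<And>i. i \<in> {1..d} \<Longrightarrow> 0 < r i) \<Longrightarrow> \<omega> \<in> lists {1..d} \<Longrightarrow> 0 < weight r \<omega>"
  by (induction \<omega>) auto

section \<open>Rigidity of product weights\<close>

text \<open>
  Split a word into consecutive blocks of the length of \<open>\<alpha>\<close>.  This is the number of occurrences of \<open>\<alpha>\<close> among
  the first \<open>n\<close> blocks minus \<open>n * a\<close>, the value expected if \<open>\<alpha>\<close> had probability \<open>a\<close>.  Disjoint blocks are used,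
  rather than all positions, because they are independent under product weights.
\<close>

fun block_deviation :: "real \<Rightarrow> nat list \<Rightarrow> nat \<Rightarrow> nat list \<Rightarrow> real" where
  "block_deviation a \<alpha> 0 \<omega> = 0"
| "block_deviation a \<alpha> (Suc n) \<omega> =
     (of_bool (take (length \<alpha>) \<omega> = \<alpha>) - a) + block_deviation a \<alpha> n (drop (length \<alpha>) \<omega>)"

lemma block_deviation_append:
  "length \<beta> = length \<alpha> \<Longrightarrow>
   block_deviation a \<alpha> (Suc n) (\<beta> @ \<omega>) = (of_bool (\<beta> = \<alpha>) - a) + block_deviation a \<alpha> n \<omega>"
  by simp

text \<open>
  Variances of independent blocks add up, and a single block contributes \<open>a - a\<^sup>2 \<le> 1\<close>.
\<close>

lemma bernoulli_block_variance:
  assumes p: "\<And>i. i \<in> {1..d} \<Longrightarrow> 0 \<le> p i" "(\<Sum>i=1..d. p i) = 1"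
    and \<alpha>: "\<alpha> \<in> lists {1..d}"
  shows "(\<Sum>\<omega>\<in>words d (n * length \<alpha>). weight p \<omega> * (block_deviation (weight p \<alpha>) \<alpha> n \<omega>)\<^sup>2)
          \<le> real n"
proof (induction n)
  case 0
  then show ?case by simp
next
  case (Suc n)
  define m where "m = length \<alpha>"
  define a where "a = weight p \<alpha>"
  define g where "g = (\<lambda>\<beta>::nat list. of_bool (\<beta> = \<alpha>) - a)"
  define G where "G = block_deviation a \<alpha> n"
  define W where "W = (\<Sum>\<omega>\<in>words d (n * m). weight p \<omega> * G \<omega>)"
  define Q where "Q = (\<Sum>\<omega>\<in>words d (n * m). weight p \<omega> * (G \<omega>)\<^sup>2)"
  have am: "\<alpha> \<in> words d m" using \<alpha> by (simp add: words_def m_def)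
  have one: "(\<Sum>\<omega>\<in>words d k. weight p \<omega>) = 1" for k
    by (simp only: sum_weight_words p(2) power_one)
  have a0: "0 \<le> a" unfolding a_def by (rule weight_nonneg[OF p(1) \<alpha>])
  have "(\<Sum>\<beta>\<in>words d m. weight p \<beta> * of_bool (\<beta> = \<alpha>)) = a"
    using am by (simp add: a_def of_bool_def if_distrib[of "\<lambda>x. _ * x"] sum.delta' cong: if_cong)
  then have g1: "(\<Sum>\<beta>\<in>words d m. weight p \<beta> * g \<beta>) = 0"
    by (simp add: g_def right_diff_distrib sum_subtractf sum_distrib_right[symmetric] one)
  have "(\<Sum>\<beta>\<in>words d m. weight p \<beta> * (g \<beta>)\<^sup>2)
      = (\<Sum>\<beta>\<in>words d m. weight p \<beta> * of_bool (\<beta> = \<alpha>) * (1 - 2 * a) + weight p \<beta> * a\<^sup>2)"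
    by (rule sum.cong) (auto simp: g_def power2_eq_square algebra_simps)
  also have "\<dots> = a * (1 - 2 * a) + a\<^sup>2"
    using \<open>(\<Sum>\<beta>\<in>words d m. weight p \<beta> * of_bool (\<beta> = \<alpha>)) = a\<close>
    by (simp add: sum.distrib sum_distrib_right[symmetric] one)
  also have "\<dots> \<le> 1"
  proof -
    have "a * (1 - 2 * a) + a\<^sup>2 = 1/4 - (a - 1/2)\<^sup>2" by (simp add: power2_eq_square algebra_simps)
    then show ?thesis using zero_le_power2[of "a - 1/2"] by linarith
  qed
  finally have g2: "(\<Sum>\<beta>\<in>words d m. weight p \<beta> * (g \<beta>)\<^sup>2) \<le> 1" .
  have "(\<Sum>\<omega>\<in>words d (Suc n * m). weight p \<omega> * (block_deviation a \<alpha> (Suc n) \<omega>)\<^sup>2)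
      = (\<Sum>\<beta>\<in>words d m. \<Sum>\<omega>\<in>words d (n * m). weight p \<beta> * weight p \<omega> * (g \<beta> + G \<omega>)\<^sup>2)"
    unfolding mult_Suc sum_words_add
    by (intro sum.cong refl, subst block_deviation_append)
       (auto simp: words_def m_def g_def G_def)
  also have "\<dots> = (\<Sum>\<beta>\<in>words d m. \<Sum>\<omega>\<in>words d (n * m).
      weight p \<beta> * (g \<beta>)\<^sup>2 * weight p \<omega> + 2 * (weight p \<beta> * g \<beta>) * (weight p \<omega> * G \<omega>)
      + weight p \<beta> * (weight p \<omega> * (G \<omega>)\<^sup>2))"
    by (intro sum.cong refl) (simp add: power2_eq_square algebra_simps)
  also have "\<dots> = (\<Sum>\<beta>\<in>words d m. weight p \<beta> * (g \<beta>)\<^sup>2 + 2 * (weight p \<beta> * g \<beta>) * W + weight p \<beta> * Q)"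
    by (simp only: sum.distrib sum_distrib_left[symmetric] one W_def Q_def mult_1_right)
  \<comment> \<open>The mixed term vanishes: \<open>g\<close> has mean \<open>0\<close> and is independent of \<open>G\<close>.\<close>
  also have "\<dots> = (\<Sum>\<beta>\<in>words d m. weight p \<beta> * (g \<beta>)\<^sup>2) + Q"
    by (simp add: sum.distrib sum_distrib_left[symmetric] sum_distrib_right[symmetric] one g1)
  also have "\<dots> \<le> 1 + real n"
    using g2 Suc.IH by (simp add: Q_def G_def a_def m_def)
  finally show ?case unfolding a_def m_def by simp
qed

text \<open>
  The assumptions \<open>right\<close> and \<open>left\<close> are the cylinder form of additivity and of shift invariance of a
  measure.  Invariance makes every block distributed like the initial one, so that each of the \<open>n\<close> blocks
  has the same expectation \<open>q \<alpha> - a\<close>.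
\<close>

lemma invariant_block_mean:
  assumes q: "q [] = 1"
    and right: "\<And>\<omega>. \<omega> \<in> lists {1..d} \<Longrightarrow> (\<Sum>i=1..d. q (\<omega> @ [i])) = q \<omega>"
    and left: "\<And>\<omega>. \<omega> \<in> lists {1..d} \<Longrightarrow> (\<Sum>i=1..d. q (i # \<omega>)) = (q \<omega> :: real)"
    and \<alpha>: "\<alpha> \<in> lists {1..d}"
  shows "(\<Sum>\<omega>\<in>words d (n * length \<alpha>). q \<omega> * block_deviation a \<alpha> n \<omega>) = real n * (q \<alpha> - a)"
    and "(\<Sum>\<omega>\<in>words d n. q \<omega>) = 1"
proof -
  have ext_right: "(\<Sum>\<omega>\<in>words d k. q (\<beta> @ \<omega>)) = q \<beta>" if "\<beta> \<in> lists {1..d}" for \<beta> k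
  proof (induction k)
    case (Suc k)
    have "(\<Sum>\<omega>\<in>words d (k + Suc 0). q (\<beta> @ \<omega>)) = (\<Sum>\<omega>\<in>words d k. \<Sum>i=1..d. q ((\<beta> @ \<omega>) @ [i]))"
      unfolding sum_words_add sum_words_1 by simp
    also have "\<dots> = (\<Sum>\<omega>\<in>words d k. q (\<beta> @ \<omega>))"
      using that by (intro sum.cong refl right) (auto simp: words_def)
    finally show ?case using Suc.IH by simp
  qed simp
  have ext_left: "(\<Sum>\<beta>\<in>words d k. q (\<beta> @ \<omega>)) = q \<omega>" if "\<omega> \<in> lists {1..d}" for \<omega> k
    using that
  proof (induction k arbitrary: \<omega>)
    case (Suc k)
    have "(\<Sum>\<beta>\<in>words d (k + Suc 0). q (\<beta> @ \<omega>)) = (\<Sum>\<beta>\<in>words d k. \<Sum>i=1..d. q (\<beta> @ (i # \<omega>)))"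
      unfolding sum_words_add sum_words_1 by simp
    also have "\<dots> = (\<Sum>i=1..d. \<Sum>\<beta>\<in>words d k. q (\<beta> @ (i # \<omega>)))"
      by (rule sum.swap)
    also have "\<dots> = (\<Sum>i=1..d. q (i # \<omega>))"
      using Suc.prems by (intro sum.cong refl Suc.IH) auto
    finally show ?case using left[OF Suc.prems] by simp
  qed simp
  show total: "(\<Sum>\<omega>\<in>words d k. q \<omega>) = 1" for k
    using ext_right[of "[]" k] q by simp
  define m where "m = length \<alpha>"
  have am: "\<alpha> \<in> words d m" using \<alpha> by (simp add: words_def m_def)
  show "(\<Sum>\<omega>\<in>words d (n * length \<alpha>). q \<omega> * block_deviation a \<alpha> n \<omega>) = real n * (q \<alpha> - a)"
  proof (induction n)
    case (Suc n)
    define g where "g = (\<lambda>\<beta>::nat list. of_bool (\<beta> = \<alpha>) - a)"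
    define G where "G = block_deviation a \<alpha> n"
    have "(\<Sum>\<beta>\<in>words d m. q \<beta> * of_bool (\<beta> = \<alpha>)) = q \<alpha>"
      using am by (simp add: of_bool_def if_distrib[of "\<lambda>x. _ * x"] sum.delta' cong: if_cong)
    then have g1: "(\<Sum>\<beta>\<in>words d m. q \<beta> * g \<beta>) = q \<alpha> - a"
      by (simp add: g_def right_diff_distrib sum_subtractf sum_distrib_right[symmetric] total)
    have "(\<Sum>\<omega>\<in>words d (Suc n * m). q \<omega> * block_deviation a \<alpha> (Suc n) \<omega>)
        = (\<Sum>\<beta>\<in>words d m. \<Sum>\<omega>\<in>words d (n * m). q (\<beta> @ \<omega>) * (g \<beta> + G \<omega>))"
      unfolding mult_Suc sum_words_add
      by (intro sum.cong refl, subst block_deviation_append)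
         (auto simp: words_def m_def g_def G_def)
    also have "\<dots> = (\<Sum>\<beta>\<in>words d m. \<Sum>\<omega>\<in>words d (n * m). q (\<beta> @ \<omega>) * g \<beta>)
                 + (\<Sum>\<beta>\<in>words d m. \<Sum>\<omega>\<in>words d (n * m). q (\<beta> @ \<omega>) * G \<omega>)"
      by (simp add: distrib_left sum.distrib)
    also have "(\<Sum>\<beta>\<in>words d m. \<Sum>\<omega>\<in>words d (n * m). q (\<beta> @ \<omega>) * G \<omega>)
             = (\<Sum>\<omega>\<in>words d (n * m). \<Sum>\<beta>\<in>words d m. q (\<beta> @ \<omega>) * G \<omega>)"
      by (rule sum.swap)
    also have "\<dots> = (\<Sum>\<omega>\<in>words d (n * m). q \<omega> * G \<omega>)"
      by (intro sum.cong refl) (simp add: sum_distrib_right[symmetric] ext_left[OF words_in_lists])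
    also have "(\<Sum>\<beta>\<in>words d m. \<Sum>\<omega>\<in>words d (n * m). q (\<beta> @ \<omega>) * g \<beta>)
             = (\<Sum>\<beta>\<in>words d m. q \<beta> * g \<beta>)"
      by (intro sum.cong refl) (simp add: sum_distrib_right[symmetric] ext_right[OF words_in_lists])
    also note g1
    finally have "(\<Sum>\<omega>\<in>words d (Suc n * m). q \<omega> * block_deviation a \<alpha> (Suc n) \<omega>)
        = (q \<alpha> - a) + real n * (q \<alpha> - a)"
      using Suc.IH unfolding m_def G_def by simp
    then show ?case unfolding m_def by (simp only: of_nat_Suc) (simp only: distrib_right mult_1_left)
  qed simp
qed

text \<open>
  A second moment argument in place of the ergodic theorem: under \<open>q\<close> the block deviation has mean
  \<open>n * (q \<alpha> - weight p \<alpha>)\<close>, while its second moment is at most \<open>C\<close> times the one under the product weights,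
  hence at most \<open>C * n\<close>.  As \<open>n\<close> grows this leaves no room for \<open>q \<alpha> \<noteq> weight p \<alpha>\<close>.
\<close>

lemma bounded_invariant_weights_eq:
  assumes p: "\<And>i. i \<in> {1..d} \<Longrightarrow> 0 \<le> p i" "(\<Sum>i=1..d. p i) = 1"
    and q: "q [] = 1" "\<And>\<omega>. \<omega> \<in> lists {1..d} \<Longrightarrow> 0 \<le> q \<omega>"
    and right: "\<And>\<omega>. \<omega> \<in> lists {1..d} \<Longrightarrow> (\<Sum>i=1..d. q (\<omega> @ [i])) = q \<omega>"
    and left: "\<And>\<omega>. \<omega> \<in> lists {1..d} \<Longrightarrow> (\<Sum>i=1..d. q (i # \<omega>)) = q \<omega>"
    and bound: "\<And>\<omega>. \<omega> \<in> lists {1..d} \<Longrightarrow> q \<omega> \<le> C * weight p \<omega>"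
    and \<alpha>: "\<alpha> \<in> lists {1..d}"
  shows "q \<alpha> = weight p \<alpha>"
proof (rule ccontr)
  assume neq: "q \<alpha> \<noteq> weight p \<alpha>"
  define \<delta> where "\<delta> = (q \<alpha> - weight p \<alpha>)\<^sup>2"
  have \<delta>: "\<delta> > 0" using neq by (simp add: \<delta>_def)
  have C: "C \<ge> 0" using bound[of "[]"] q by simp
  have main: "real n * \<delta> \<le> C" if n: "n > 0" for n
  proof -
    define G where "G = block_deviation (weight p \<alpha>) \<alpha> n"
    define t where "t = real n * (q \<alpha> - weight p \<alpha>)"
    let ?W = "words d (n * length \<alpha>)"
    have mean: "(\<Sum>\<omega>\<in>?W. q \<omega> * G \<omega>) = t" "(\<Sum>\<omega>\<in>?W. q \<omega>) = 1"
      unfolding G_def t_def using invariant_block_mean[OF q(1) right left \<alpha>] by auto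
    \<comment> \<open>Second moments dominate squared first moments.\<close>
    have "0 \<le> (\<Sum>\<omega>\<in>?W. q \<omega> * (G \<omega> - t)\<^sup>2)"
      by (intro sum_nonneg mult_nonneg_nonneg q(2) words_in_lists) auto
    also have "\<dots> = (\<Sum>\<omega>\<in>?W. q \<omega> * (G \<omega>)\<^sup>2 - (q \<omega> * G \<omega>) * (2 * t) + q \<omega> * t\<^sup>2)"
      by (intro sum.cong refl) (simp add: power2_eq_square algebra_simps)
    also have "\<dots> = (\<Sum>\<omega>\<in>?W. q \<omega> * (G \<omega>)\<^sup>2) - t\<^sup>2"
      by (simp add: sum.distrib sum_subtractf sum_distrib_right[symmetric] mean power2_eq_square)
    finally have "t\<^sup>2 \<le> (\<Sum>\<omega>\<in>?W. q \<omega> * (G \<omega>)\<^sup>2)" by simp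
    also have "\<dots> \<le> (\<Sum>\<omega>\<in>?W. C * (weight p \<omega> * (G \<omega>)\<^sup>2))"
    proof (rule sum_mono)
      fix \<omega> assume "\<omega> \<in> ?W"
      then have "q \<omega> * (G \<omega>)\<^sup>2 \<le> (C * weight p \<omega>) * (G \<omega>)\<^sup>2"
        by (intro mult_right_mono bound words_in_lists) auto
      then show "q \<omega> * (G \<omega>)\<^sup>2 \<le> C * (weight p \<omega> * (G \<omega>)\<^sup>2)" by (simp add: mult.assoc)
    qed
    also have "\<dots> = C * (\<Sum>\<omega>\<in>?W. weight p \<omega> * (G \<omega>)\<^sup>2)"
      by (simp add: sum_distrib_left)
    also have "\<dots> \<le> C * real n"
      unfolding G_def by (intro mult_left_mono bernoulli_block_variance p \<alpha> C)
    finally have "real n * (real n * \<delta>) \<le> real n * C"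
      by (simp add: t_def \<delta>_def power_mult_distrib power2_eq_square mult_ac)
    then show ?thesis using n by simp
  qed
  obtain n :: nat where "C / \<delta> < real n" using reals_Archimedean2 by blast
  then have "C < real n * \<delta>" using \<delta> by (simp add: field_simps)
  moreover have "n > 0" using \<open>C / \<delta> < real n\<close> C \<delta> by (cases n) (auto simp: field_simps)
  ultimately show False using main[of n] by linarith
qed

section \<open>Bernoulli measures on the shift space\<close>

definition bernoulli_measure :: "nat \<Rightarrow> (nat \<Rightarrow> real) \<Rightarrow> nat stream measure" where
  "bernoulli_measure d p = stream_space (point_measure {1..d} p)"

lemma sets_bernoulli_measure:
  "sets (bernoulli_measure d p) = sets (stream_space (count_space {1..d}))"
  unfolding bernoulli_measure_def by (rule sets_stream_space_cong) (simp add: sets_point_measure)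

lemma space_eq_streams:
  "sets M = sets (stream_space (count_space S)) \<Longrightarrow> space M = streams S"
  by (drule sets_eq_imp_space_eq) (simp add: space_stream_space)

lemma sstart_subset_Pow_streams: "sstart S ` lists S \<union> {{}} \<subseteq> Pow (streams S)"
  by (simp add: image_subset_iff sstart_in_streams)

lemma sets_streams_generated:
  "sets (stream_space (count_space {1..d::nat})) =
    sigma_sets (streams {1..d}) (sstart {1..d} ` lists {1..d} \<union> {{}})"
  unfolding sets_stream_space_sstart[OF countable_finite[OF finite_atLeastAtMost]]
  by (rule sets_measure_of[OF sstart_subset_Pow_streams])

lemma sstart_in_sets:
  fixes d :: nat
  assumes "sets M = sets (stream_space (count_space {1..d}))" "\<omega> \<in> lists {1..d}"
  shows "sstart {1..d} \<omega> \<in> sets M"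
proof -
  show ?thesis
    unfolding assms(1) sets_streams_generated
    using assms(2) by (intro sigma_sets.Basic UnI1 imageI)
qed

lemma stream_measure_eqI:
  fixes d :: nat
  assumes M: "prob_space M" "sets M = sets (stream_space (count_space {1..d}))"
    and N: "prob_space N" "sets N = sets (stream_space (count_space {1..d}))"
    and eq: "\<And>\<omega>. \<omega> \<in> lists {1..d} \<Longrightarrow> measure M (sstart {1..d} \<omega>) = measure N (sstart {1..d} \<omega>)"
  shows "M = N"
proof (rule measure_eqI_generator_eq[OF Int_stable_sstart])
  interpret M: prob_space M by fact
  interpret N: prob_space N by fact
  let ?E = "sstart {1..d} ` lists {1..d} \<union> {{}}"
  show "?E \<subseteq> Pow (streams {1..d})" by (rule sstart_subset_Pow_streams)
  show "sets M = sigma_sets (streams {1..d}) ?E" "sets N = sigma_sets (streams {1..d}) ?E"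
    unfolding M(2) N(2) by (rule sets_streams_generated)+
  show "emeasure M A = emeasure N A" if "A \<in> ?E" for A
  proof (cases "A = {}")
    case False
    then have "A \<in> sstart {1..d} ` lists {1..d}" using that by (simp del: in_lists_conv_set)
    then obtain \<omega> where \<omega>: "\<omega> \<in> lists {1..d}" and A: "A = sstart {1..d} \<omega>" by (rule imageE)
    show ?thesis by (simp only: A M.emeasure_eq_measure N.emeasure_eq_measure eq[OF \<omega>])
  qed simp
  show "range (\<lambda>i::nat. streams {1..d}) \<subseteq> ?E"
    by (auto intro!: image_eqI[where x="[]"])
qed (use prob_space.finite_measure[OF M(1)] in \<open>auto simp: finite_measure.emeasure_finite\<close>)

lemma stl_measurable_streams:
  assumes "sets M = sets (stream_space (count_space S))"
  shows "stl \<in> measurable M M"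
  unfolding measurable_cong_sets[OF assms assms] by (rule measurable_stl)

context
  fixes d :: nat and p :: "nat \<Rightarrow> real"
  assumes p: "\<And>i. i \<in> {1..d} \<Longrightarrow> 0 \<le> p i" "(\<Sum>i=1..d. p i) = 1"
begin

lemma sum_ennreal_weights: "(\<Sum>i=1..d. ennreal (p i)) = 1"
proof -
  have "(\<Sum>i=1..d. ennreal (p i)) = ennreal (\<Sum>i=1..d. p i)" by (rule sum_ennreal) (rule p(1))
  then show ?thesis by (simp only: p(2) ennreal_1)
qed

lemma prob_space_letter: "prob_space (point_measure {1..d} p)"
proof (rule prob_spaceI)
  show "emeasure (point_measure {1..d} p) (space (point_measure {1..d} p)) = 1"
    using sum_ennreal_weights by (simp add: space_point_measure emeasure_point_measure_finite del: sum_ennreal)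
qed

lemma prob_space_bernoulli_measure: "prob_space (bernoulli_measure d p)"
  unfolding bernoulli_measure_def
  by (rule prob_space.prob_space_stream_space[OF prob_space_letter])

text \<open>
  Conditioning on the first letter, which is independent of the remaining sequence.
\<close>

lemma emeasure_bernoulli_measure_split:
  assumes "A \<in> sets (bernoulli_measure d p)"
  shows "emeasure (bernoulli_measure d p) A =
    (\<Sum>i=1..d. ennreal (p i) * emeasure (bernoulli_measure d p) {x \<in> streams {1..d}. i ## x \<in> A})"
proof -
  let ?P = "point_measure {1..d} p"
  have "emeasure (stream_space ?P) A =
      (\<integral>\<^sup>+t. emeasure (stream_space ?P) {x \<in> space (stream_space ?P). t ## x \<in> A} \<partial>?P)"
    by (rule prob_space.emeasure_stream_space[OF prob_space_letter assms[unfolded bernoulli_measure_def]])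
  also have "\<dots> = (\<Sum>i=1..d. ennreal (p i) * emeasure (stream_space ?P) {x \<in> space (stream_space ?P). i ## x \<in> A})"
    by (rule nn_integral_point_measure_finite) simp
  finally show ?thesis
    by (simp only: bernoulli_measure_def space_stream_space space_point_measure)
qed

lemma bernoulli_measure_sstart:
  assumes \<omega>_lists: "\<omega> \<in> lists {1..d}"
  shows "measure (bernoulli_measure d p) (sstart {1..d} \<omega>) = weight p \<omega>"
proof -
  interpret B: prob_space "bernoulli_measure d p" by (rule prob_space_bernoulli_measure)
  from \<omega>_lists show ?thesis
  proof (induction rule: lists.induct)
    case Nil
    then show ?case using B.prob_space by (simp add: space_eq_streams[OF sets_bernoulli_measure])
  next
    case (Cons i \<omega>)
    note i = \<open>i \<in> {1..d}\<close> and \<omega> = \<open>\<omega> \<in> lists {1..d}\<close>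
    have i\<omega>: "i # \<omega> \<in> lists {1..d}" using i \<omega> by (rule lists.Cons)
    have "{x \<in> streams {1..d}. x \<in> sstart {1..d} \<omega>} = sstart {1..d} \<omega>"
      using sstart_in_streams[OF \<omega>] by blast
    then have slice: "{x \<in> streams {1..d}. j ## x \<in> sstart {1..d} (i # \<omega>)}
        = (if j = i then sstart {1..d} \<omega> else {})" for j by simp
    have "emeasure (bernoulli_measure d p) (sstart {1..d} (i # \<omega>))
        = (\<Sum>j=1..d. ennreal (p j) * emeasure (bernoulli_measure d p) (if j = i then sstart {1..d} \<omega> else {}))"
      by (simp only: slice emeasure_bernoulli_measure_split[OF sstart_in_sets[OF sets_bernoulli_measure i\<omega>]])
    also have "\<dots> = (\<Sum>j=1..d. if j = i then ennreal (p j) * emeasure (bernoulli_measure d p) (sstart {1..d} \<omega>) else 0)"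
      by (rule sum.cong) auto
    also have "\<dots> = ennreal (p i) * emeasure (bernoulli_measure d p) (sstart {1..d} \<omega>)"
      using i by simp
    also have "\<dots> = ennreal (weight p (i # \<omega>))"
      using p(1)[OF i] weight_nonneg[of d p \<omega>] p(1) \<omega>
      by (simp add: B.emeasure_eq_measure Cons.IH ennreal_mult del: in_lists_conv_set)
    moreover have "0 \<le> weight p (i # \<omega>)" using weight_nonneg[of d p "i # \<omega>"] p(1) i\<omega> by blast
    ultimately show ?case by (simp only: measure_eq_emeasure_eq_ennreal)
  qed
qed

lemma bernoulli_measure_invariant: "distr (bernoulli_measure d p) (bernoulli_measure d p) stl = bernoulli_measure d p"
proof (rule measure_eqI)
  let ?B = "bernoulli_measure d p"
  fix A assume "A \<in> sets (distr ?B ?B stl)"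
  then have A: "A \<in> sets ?B" by simp
  have sp: "space ?B = streams {1..d}" by (rule space_eq_streams[OF sets_bernoulli_measure])
  note stl = stl_measurable_streams[OF sets_bernoulli_measure]
  have "{x \<in> streams {1..d}. i ## x \<in> stl -` A \<inter> space ?B} = A" if "i \<in> {1..d}" for i
    using that sets.sets_into_space[OF A] by (auto simp: sp streams_Stream)
  then have "emeasure ?B (stl -` A \<inter> space ?B) = (\<Sum>i=1..d. ennreal (p i) * emeasure ?B A)"
    by (subst emeasure_bernoulli_measure_split) (auto intro!: sum.cong measurable_sets[OF stl A])
  also have "\<dots> = emeasure ?B A"
    by (simp only: sum_distrib_right[symmetric] sum_ennreal_weights mult_1_left)
  finally show "emeasure (distr ?B ?B stl) A = emeasure ?B A"
    by (simp add: emeasure_distr[OF stl A])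
qed simp

text \<open>
  The masses that an invariant measure gives to cylinders form an invariant system of weights, so this is
  the rigidity of product weights in terms of measures.  It is what makes Gibbs measures unique.
\<close>

lemma invariant_eq_bernoulli_measure:
  assumes M: "prob_space M" "sets M = sets (stream_space (count_space {1..d}))" "distr M M stl = M"
    and bound: "\<And>\<omega>. \<omega> \<in> lists {1..d} \<Longrightarrow> measure M (sstart {1..d} \<omega>) \<le> C * weight p \<omega>"
  shows "M = bernoulli_measure d p"
proof (rule stream_measure_eqI[OF M(1,2) prob_space_bernoulli_measure sets_bernoulli_measure])
  interpret M: prob_space M by fact
  note sp = space_eq_streams[OF M(2)] and meas = sstart_in_sets[OF M(2)]
  define q where "q = (\<lambda>\<omega>. measure M (sstart {1..d} \<omega>))"
  fix \<omega> assume \<omega>: "\<omega> \<in> lists {1..d}"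
  have "q \<omega> = weight p \<omega>"
  proof (rule bounded_invariant_weights_eq[of d p q C])
    show "q [] = 1" using M.prob_space by (simp add: q_def sp)
    show "0 \<le> q \<alpha>" for \<alpha> by (simp add: q_def)
    show "q \<alpha> \<le> C * weight p \<alpha>" if "\<alpha> \<in> lists {1..d}" for \<alpha>
      unfolding q_def by (rule bound[OF that])
    show "(\<Sum>i=1..d. q (\<alpha> @ [i])) = q \<alpha>" if \<alpha>: "\<alpha> \<in> lists {1..d}" for \<alpha>
    proof -
      have mem: "x \<in> sstart {1..d} (\<alpha> @ [i]) \<longleftrightarrow> x \<in> sstart {1..d} \<alpha> \<and> x !! length \<alpha> = i"
        if "i \<in> {1..d}" for x i
        using that
        by (induction \<alpha> arbitrary: x) (auto simp: streams_Stream streams_stl streams_shd intro: in_streams)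
      have "sstart {1..d} \<alpha> = (\<Union>i\<in>{1..d}. sstart {1..d} (\<alpha> @ [i]))"
        using mem snth_in[OF subsetD[OF sstart_in_streams[OF \<alpha>]]] by auto
      moreover have "measure M (\<Union>i\<in>{1..d}. sstart {1..d} (\<alpha> @ [i])) = (\<Sum>i=1..d. q (\<alpha> @ [i]))"
        unfolding q_def
      proof (rule M.finite_measure_finite_Union)
        show "(\<lambda>i. sstart {1..d} (\<alpha> @ [i])) ` {1..d} \<subseteq> sets M"
          using \<alpha> by (intro image_subsetI meas) auto
        show "disjoint_family_on (\<lambda>i. sstart {1..d} (\<alpha> @ [i])) {1..d}"
          unfolding disjoint_family_on_def by (simp add: set_eq_iff mem del: atLeastAtMost_iff)
      qed simp
      ultimately show ?thesis by (simp add: q_def)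
    qed
    show "(\<Sum>i=1..d. q (i # \<alpha>)) = q \<alpha>" if \<alpha>: "\<alpha> \<in> lists {1..d}" for \<alpha>
    proof -
      have "q \<alpha> = measure (distr M M stl) (sstart {1..d} \<alpha>)" by (simp add: q_def M(3))
      also have "\<dots> = measure M (stl -` sstart {1..d} \<alpha> \<inter> space M)"
        by (rule measure_distr[OF stl_measurable_streams[OF M(2)] meas[OF \<alpha>]])
      also have "stl -` sstart {1..d} \<alpha> \<inter> space M = (\<Union>i\<in>{1..d}. sstart {1..d} (i # \<alpha>))"
      proof (intro set_eqI)
        fix x
        have "x \<in> streams {1..d} \<longleftrightarrow> shd x \<in> {1..d} \<and> stl x \<in> streams {1..d}"
          by (cases x) (simp only: streams_Stream stream.sel)
        then show "x \<in> stl -` sstart {1..d} \<alpha> \<inter> space M \<longleftrightarrow> x \<in> (\<Union>i\<in>{1..d}. sstart {1..d} (i # \<alpha>))"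
          using sstart_in_streams[OF \<alpha>] by (auto simp: sp simp del: atLeastAtMost_iff)
      qed
      also have "measure M \<dots> = (\<Sum>i=1..d. q (i # \<alpha>))"
        unfolding q_def using \<alpha>
        by (intro M.finite_measure_finite_Union) (auto intro!: meas simp: disjoint_family_on_def)
      finally show ?thesis by simp
    qed
  qed (rule p \<omega> | assumption)+
  then show "measure M (sstart {1..d} \<omega>) = measure (bernoulli_measure d p) (sstart {1..d} \<omega>)"
    by (simp add: q_def bernoulli_measure_sstart[OF \<omega>] del: in_lists_conv_set)
qed

end

section \<open>Pressure and Gibbs measures determined by contraction ratios\<close>

text \<open>
  The logarithmic form of \<open>exp (S\<^sub>n I\<^sub>\<Phi> x) \<asymp> weight r (stake n x)\<close>, uniformly in \<open>n\<close> and \<open>x\<close>.  For an affine system the \<open>r\<^sub>i\<close> are the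
  absolute values of the slopes.  The error term is what makes the property invariant under bi-Lipschitz
  conjugacy.
\<close>

definition has_ratios :: "nat \<Rightarrow> ifs \<Rightarrow> (nat \<Rightarrow> real) \<Rightarrow> bool" where
  "has_ratios d \<Phi> r \<longleftrightarrow> (\<forall>i\<in>{1..d}. 0 < r i) \<and>
     (\<exists>D. \<forall>\<omega>\<in>lists {1..d}. \<forall>x\<in>sstart {1..d} \<omega>.
        \<bar>birkhoff_sum (geometric_potential \<Phi>) (length \<omega>) x - ln (weight r \<omega>)\<bar> \<le> D)"

lemma ln_weight_powr:
  "(\<And>i. i \<in> {1..d} \<Longrightarrow> 0 < r i) \<Longrightarrow> \<omega> \<in> lists {1..d} \<Longrightarrow>
   ln (weight (\<lambda>i. r i powr u) \<omega>) = u * ln (weight r \<omega>)"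
proof (induction \<omega>)
  case (Cons i \<omega>)
  have powr: "0 < r j powr u" if "j \<in> {1..d}" for j using Cons.prems(1)[OF that] by simp
  have *: "0 < r i" "0 < weight r \<omega>" "0 < weight (\<lambda>i. r i powr u) \<omega>"
    using Cons.prems weight_pos[of d r \<omega>] weight_pos[of d "\<lambda>i. r i powr u" \<omega>, OF powr] by auto
  then show ?case using Cons by (simp add: ln_mult ln_powr distrib_left)
qed simp

lemma weight_divide: "weight (\<lambda>i. r i / c) \<omega> = weight r \<omega> / (c::real) ^ length \<omega>"
  by (induction \<omega>) simp_all

lemma birkhoff_sum_mult: "birkhoff_sum (\<lambda>x. u * f x) n x = u * birkhoff_sum f n x"
  by (simp add: birkhoff_sum_def sum_distrib_left)

lemma has_ratios_scaled:
  assumes "has_ratios d \<Phi> r"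
  obtains D where "D \<ge> 0" and "\<And>\<omega> x. \<omega> \<in> lists {1..d} \<Longrightarrow> x \<in> sstart {1..d} \<omega> \<Longrightarrow>
    \<bar>u * birkhoff_sum (geometric_potential \<Phi>) (length \<omega>) x - ln (weight (\<lambda>i. r i powr u) \<omega>)\<bar> \<le> D"
proof -
  obtain D where r: "\<And>i. i \<in> {1..d} \<Longrightarrow> 0 < r i" and D: "\<And>\<omega> x. \<omega> \<in> lists {1..d} \<Longrightarrow>
      x \<in> sstart {1..d} \<omega> \<Longrightarrow>
      \<bar>birkhoff_sum (geometric_potential \<Phi>) (length \<omega>) x - ln (weight r \<omega>)\<bar> \<le> D"
    using assms unfolding has_ratios_def by blast
  show ?thesis
  proof
    show "\<bar>u\<bar> * \<bar>D\<bar> \<ge> 0" by simp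
    fix \<omega> x assume \<omega>: "\<omega> \<in> lists {1..d}" and x: "x \<in> sstart {1..d} \<omega>"
    have "\<bar>u * birkhoff_sum (geometric_potential \<Phi>) (length \<omega>) x - ln (weight (\<lambda>i. r i powr u) \<omega>)\<bar>
        = \<bar>u\<bar> * \<bar>birkhoff_sum (geometric_potential \<Phi>) (length \<omega>) x - ln (weight r \<omega>)\<bar>"
      by (simp only: ln_weight_powr[OF r \<omega>] right_diff_distrib[symmetric] abs_mult)
    also have "\<dots> \<le> \<bar>u\<bar> * \<bar>D\<bar>"
      using D[OF \<omega> x] by (intro mult_left_mono) auto
    finally show "\<bar>u * birkhoff_sum (geometric_potential \<Phi>) (length \<omega>) x
        - ln (weight (\<lambda>i. r i powr u) \<omega>)\<bar> \<le> \<bar>u\<bar> * \<bar>D\<bar>" .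
  qed
qed

lemma sstart_nonempty:
  assumes "d \<ge> (1::nat)" "\<omega> \<in> lists {1..d}"
  shows "sstart {1..d} \<omega> \<noteq> {}"
proof -
  have "streams {1..d} \<noteq> {}" unfolding streams_empty_iff using assms(1) by simp
  then obtain y where y: "y \<in> streams {1..d}" by blast
  have "\<omega> @- y \<in> sstart {1..d} \<omega>"
    using assms(2) by (induction \<omega>) (simp_all add: y)
  then show ?thesis by blast
qed

lemma sum_powr_pos:
  fixes r :: "nat \<Rightarrow> real"
  assumes "d \<ge> 1" "\<And>i. i \<in> {1..d} \<Longrightarrow> 0 < r i"
  shows "0 < (\<Sum>i=1..d. r i powr u)"
proof (rule sum_pos)
  fix i assume "i \<in> {1..d}"
  then show "0 < r i powr u" using assms(2)[of i] by simp
qed (use assms(1) in auto)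

text \<open>
  The partition sum over words of length \<open>n\<close> differs from \<open>(\<Sum>i. r\<^sub>i powr u) ^ n\<close> at most by a factor between
  \<open>exp (- D)\<close> and \<open>exp D\<close>, which disappears in the limit of \<open>ln (\<dots>) / n\<close>.
\<close>

lemma ifs_pressure_eq:
  assumes d: "d \<ge> 1" and ratios: "has_ratios d \<Phi> r"
  shows "ifs_pressure d \<Phi> u = ln (\<Sum>i=1..d. r i powr u)"
proof -
  have r: "\<And>i. i \<in> {1..d} \<Longrightarrow> 0 < r i" using ratios by (auto simp: has_ratios_def)
  define w where "w = (\<lambda>i. r i powr u)"
  define Z where "Z = (\<Sum>i=1..d. w i)"
  have w: "0 < w i" if "i \<in> {1..d}" for i using r[OF that] by (simp add: w_def)
  have Z: "Z > 0" unfolding Z_def w_def by (rule sum_powr_pos[of d r u, OF d r])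
  obtain D where D: "D \<ge> 0" "\<And>\<omega> x. \<omega> \<in> lists {1..d} \<Longrightarrow> x \<in> sstart {1..d} \<omega> \<Longrightarrow>
    \<bar>u * birkhoff_sum (geometric_potential \<Phi>) (length \<omega>) x - ln (weight w \<omega>)\<bar> \<le> D"
    using has_ratios_scaled[OF ratios, of u] unfolding w_def by blast
  define s where "s = (\<lambda>n \<omega>. SUP x\<in>sstart {1..d} \<omega>. birkhoff_sum (\<lambda>x. u * geometric_potential \<Phi> x) n x)"
  define T where "T = (\<lambda>n. \<Sum>\<omega>\<in>words d n. exp (s n \<omega>))"
  have s: "exp (- D) * weight w \<omega> \<le> exp (s n \<omega>) \<and> exp (s n \<omega>) \<le> exp D * weight w \<omega>"
    if "\<omega> \<in> words d n" for n \<omega>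
  proof -
    have \<omega>: "\<omega> \<in> lists {1..d}" and n: "n = length \<omega>" using that by (auto simp: words_def)
    have pos: "0 < weight w \<omega>" by (rule weight_pos[OF w \<omega>])
    have *: "ln (weight w \<omega>) - D \<le> u * birkhoff_sum (geometric_potential \<Phi>) n x"
       "u * birkhoff_sum (geometric_potential \<Phi>) n x \<le> ln (weight w \<omega>) + D"
      if "x \<in> sstart {1..d} \<omega>" for x using D(2)[OF \<omega> that] n by auto
    obtain x where x: "x \<in> sstart {1..d} \<omega>" using sstart_nonempty[OF d \<omega>] by blast
    have "s n \<omega> \<le> ln (weight w \<omega>) + D"
      unfolding s_def birkhoff_sum_mult using sstart_nonempty[OF d \<omega>] *(2) by (rule cSUP_least)
    moreover have "ln (weight w \<omega>) - D \<le> s n \<omega>"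
      unfolding s_def birkhoff_sum_mult
      using *(2) by (intro order_trans[OF *(1)[OF x]] cSUP_upper x) (auto simp: bdd_above_def)
    ultimately have "exp (ln (weight w \<omega>) - D) \<le> exp (s n \<omega>)" "exp (s n \<omega>) \<le> exp (ln (weight w \<omega>) + D)"
      by simp_all
    then show ?thesis using pos by (simp add: exp_diff exp_add exp_minus field_simps)
  qed
  have T: "exp (- D) * Z ^ n \<le> T n \<and> T n \<le> exp D * Z ^ n" for n
  proof -
    have "exp (- D) * Z ^ n = (\<Sum>\<omega>\<in>words d n. exp (- D) * weight w \<omega>)"
      "exp D * Z ^ n = (\<Sum>\<omega>\<in>words d n. exp D * weight w \<omega>)"
      by (simp_all only: sum_distrib_left[symmetric] sum_weight_words Z_def)
    then show ?thesis unfolding T_def using s by (auto intro!: sum_mono)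
  qed
  have close: "\<bar>ln (T n) / real n - ln Z\<bar> \<le> D / real n" if n: "n > 0" for n
  proof -
    have "0 < exp (- D) * Z ^ n" using Z by simp
    then have "ln (exp (- D) * Z ^ n) \<le> ln (T n)" "ln (T n) \<le> ln (exp D * Z ^ n)"
      using T[of n] by (meson less_le_trans ln_mono)+
    then have "\<bar>ln (T n) - real n * ln Z\<bar> \<le> D"
      using Z by (simp add: ln_mult ln_realpow)
    then have "\<bar>ln (T n) - real n * ln Z\<bar> / real n \<le> D / real n"
      by (intro divide_right_mono) auto
    moreover have "ln (T n) / real n - ln Z = (ln (T n) - real n * ln Z) / real n"
      using n by (simp add: field_simps)
    ultimately show ?thesis by simp
  qed
  have "(\<lambda>n. ln (T n) / real n - ln Z) \<longlonglongrightarrow> 0"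
  proof (rule Lim_null_comparison[OF _ lim_const_over_n[of D]])
    show "\<forall>\<^sub>F n in sequentially. norm (ln (T n) / real n - ln Z) \<le> D / real n"
      using eventually_gt_at_top[of "0::nat"] by eventually_elim (simp add: close)
  qed
  then have "(\<lambda>n. ln (T n) / real n) \<longlonglongrightarrow> ln Z" by (rule LIM_zero_cancel)
  then show ?thesis
    unfolding ifs_pressure_def pressure_def T_def s_def Z_def w_def by (rule limI)
qed

definition gibbs_weights :: "nat \<Rightarrow> (nat \<Rightarrow> real) \<Rightarrow> real \<Rightarrow> nat \<Rightarrow> real" where
  "gibbs_weights d r u i = r i powr u / (\<Sum>j=1..d. r j powr u)"

lemma gibbs_weights:
  assumes d: "d \<ge> 1" and r: "\<And>i. i \<in> {1..d} \<Longrightarrow> 0 < r i"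
  shows "i \<in> {1..d} \<Longrightarrow> 0 < gibbs_weights d r u i" "(\<Sum>i=1..d. gibbs_weights d r u i) = 1"
proof -
  note Z = sum_powr_pos[of d r u, OF d r]
  show "i \<in> {1..d} \<Longrightarrow> 0 < gibbs_weights d r u i"
    using Z r[of i] by (simp add: gibbs_weights_def)
  show "(\<Sum>i=1..d. gibbs_weights d r u i) = 1"
    using Z unfolding gibbs_weights_def sum_divide_distrib[symmetric] by simp
qed

text \<open>
  Divided by the exponential of the pressure, the numbers \<open>r\<^sub>i powr u\<close> become probability weights, and the
  Gibbs property turns into comparability with a Bernoulli measure on cylinders.
\<close>

lemma is_gibbs_iff_bernoulli:
  assumes d: "d \<ge> 1" and ratios: "has_ratios d \<Phi> r"
  shows "is_gibbs d \<Phi> u M \<longleftrightarrow> M = bernoulli_measure d (gibbs_weights d r u)"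
proof -
  define p where "p = gibbs_weights d r u"
  have r: "\<And>i. i \<in> {1..d} \<Longrightarrow> 0 < r i" using ratios by (auto simp: has_ratios_def)
  have p: "\<And>i. i \<in> {1..d} \<Longrightarrow> 0 < p i" "(\<Sum>i=1..d. p i) = 1"
    using gibbs_weights[of d r, OF d r] unfolding p_def by blast+
  then have p0: "\<And>i. i \<in> {1..d} \<Longrightarrow> 0 \<le> p i" by (simp add: less_imp_le)
  define Z where "Z = (\<Sum>i=1..d. r i powr u)"
  have Z: "Z > 0" unfolding Z_def by (rule sum_powr_pos[of d r u, OF d r])
  obtain D where D: "D \<ge> 0" "\<And>\<omega> x. \<omega> \<in> lists {1..d} \<Longrightarrow> x \<in> sstart {1..d} \<omega> \<Longrightarrow>
    \<bar>u * birkhoff_sum (geometric_potential \<Phi>) (length \<omega>) x - ln (weight (\<lambda>i. r i powr u) \<omega>)\<bar> \<le> D"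
    using has_ratios_scaled[OF ratios, of u] by blast
  define e where "e = (\<lambda>n x. exp (u * birkhoff_sum (geometric_potential \<Phi>) n x - real n * ifs_pressure d \<Phi> u))"
  have e: "exp (- D) * weight p \<omega> \<le> e n x \<and> e n x \<le> exp D * weight p \<omega>"
    if "\<omega> \<in> words d n" and x: "x \<in> sstart {1..d} \<omega>" for n \<omega> x
  proof -
    have \<omega>: "\<omega> \<in> lists {1..d}" and n: "n = length \<omega>" using that by (auto simp: words_def)
    have w: "0 < weight (\<lambda>i. r i powr u) \<omega>"
    proof (rule weight_pos[OF _ \<omega>])
      show "0 < r i powr u" if "i \<in> {1..d}" for i using r[OF that] by simp
    qed
    have pw: "0 < weight p \<omega>" by (rule weight_pos[OF p(1) \<omega>])
    have "weight p \<omega> = weight (\<lambda>i. r i powr u) \<omega> / Z ^ length \<omega>"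
      unfolding p_def gibbs_weights_def[abs_def] Z_def by (rule weight_divide)
    then have lnp: "ln (weight p \<omega>) = ln (weight (\<lambda>i. r i powr u) \<omega>) - real n * ln Z"
      using w Z n by (simp add: ln_div ln_realpow)
    have "e n x = exp (u * birkhoff_sum (geometric_potential \<Phi>) n x - real n * ln Z)"
      by (simp add: e_def Z_def ifs_pressure_eq[OF d ratios])
    moreover have "ln (weight p \<omega>) - D \<le> u * birkhoff_sum (geometric_potential \<Phi>) n x - real n * ln Z"
        "u * birkhoff_sum (geometric_potential \<Phi>) n x - real n * ln Z \<le> ln (weight p \<omega>) + D"
      using D(2)[OF \<omega> x] lnp n by auto
    ultimately have "exp (ln (weight p \<omega>) - D) \<le> e n x" "e n x \<le> exp (ln (weight p \<omega>) + D)"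
      by simp_all
    then show ?thesis using pw by (simp add: exp_diff exp_add exp_minus field_simps)
  qed
  show ?thesis
  proof
    assume "is_gibbs d \<Phi> u M"
    then obtain C where M: "prob_space M" "sets M = sets (stream_space (count_space {1..d}))"
        "distr M M stl = M" and C: "C \<ge> 1" "\<And>n \<omega> x. \<omega> \<in> words d n \<Longrightarrow> x \<in> sstart {1..d} \<omega> \<Longrightarrow>
          measure M (sstart {1..d} \<omega>) \<le> C * e n x"
      unfolding is_gibbs_def Let_def e_def by blast
    have "measure M (sstart {1..d} \<omega>) \<le> (C * exp D) * weight p \<omega>" if \<omega>: "\<omega> \<in> lists {1..d}" for \<omega>
    proof -
      have \<omega>': "\<omega> \<in> words d (length \<omega>)" using \<omega> by (simp add: words_def)
      obtain x where x: "x \<in> sstart {1..d} \<omega>" using sstart_nonempty[OF d \<omega>] by blast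
      have "measure M (sstart {1..d} \<omega>) \<le> C * e (length \<omega>) x" by (rule C(2)[OF \<omega>' x])
      also have "\<dots> \<le> C * (exp D * weight p \<omega>)"
        using e[OF \<omega>' x] C(1) by (intro mult_left_mono) auto
      finally show ?thesis by (simp add: mult.assoc)
    qed
    then show "M = bernoulli_measure d (gibbs_weights d r u)"
      unfolding p_def[symmetric] by (intro invariant_eq_bernoulli_measure[where d = d and p = p, OF p0 p(2) M])
  next
    assume "M = bernoulli_measure d (gibbs_weights d r u)"
    then have M: "M = bernoulli_measure d p" by (simp add: p_def)
    have "\<exists>C\<ge>1. \<forall>n. \<forall>\<omega>\<in>words d n. \<forall>x\<in>sstart {1..d} \<omega>.
        e n x / C \<le> measure M (sstart {1..d} \<omega>) \<and> measure M (sstart {1..d} \<omega>) \<le> C * e n x"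
    proof (intro exI[of _ "exp D"] conjI allI ballI)
      fix n \<omega> x assume \<omega>: "\<omega> \<in> words d n" and x: "x \<in> sstart {1..d} \<omega>"
      have "measure M (sstart {1..d} \<omega>) = weight p \<omega>"
        unfolding M using \<omega> by (intro bernoulli_measure_sstart p0 p(2) words_in_lists)
      then show "e n x / exp D \<le> measure M (sstart {1..d} \<omega>)" "measure M (sstart {1..d} \<omega>) \<le> exp D * e n x"
        using e[OF \<omega> x] by (simp_all add: exp_minus field_simps)
    qed (use D in simp)
    then show "is_gibbs d \<Phi> u M"
      unfolding is_gibbs_def Let_def e_def
      using prob_space_bernoulli_measure[of d p, OF p0 p(2)] bernoulli_measure_invariant[of d p, OF p0 p(2)]
      by (simp add: M sets_bernoulli_measure)
  qed
qed

lemma gibbs_measure_eq_bernoulli: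
  assumes "d \<ge> 1" "has_ratios d \<Phi> r"
  shows "gibbs_measure d \<Phi> u = bernoulli_measure d (gibbs_weights d r u)"
  unfolding gibbs_measure_def is_gibbs_iff_bernoulli[OF assms] by (rule the_equality) (rule refl)

section \<open>Coding of the limit set\<close>

text \<open>
  Conformality speaks about complex derivatives of an extension and the geometric potential about real
  derivatives.  They agree up to the embedding, because the difference quotients of \<open>f\<close> along the real line
  are real.
\<close>

lemma real_derivative_of_complex_extension:
  fixes f :: "complex \<Rightarrow> complex" and g :: "real \<Rightarrow> real"
  assumes f: "(f has_field_derivative f') (at (of_real t))"
    and T: "open T" "t \<in> T" and eq: "\<And>s. s \<in> T \<Longrightarrow> f (of_real s) = of_real (g s)"
  shows "(g has_real_derivative Re f') (at t)" "Im f' = 0"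
proof -
  have "((\<lambda>s. f (of_real s)) has_vector_derivative f') (at t)"
    using f has_field_derivative_imp_has_derivative[OF f]
    by (intro has_vector_derivative_real_field) auto
  then have v: "((\<lambda>s. complex_of_real (g s)) has_vector_derivative f') (at t)"
    by (rule has_vector_derivative_transform_within_open[OF _ T]) (rule eq)
  have "((\<lambda>s. Re (complex_of_real (g s))) has_vector_derivative Re f') (at t)"
    using bounded_linear.has_vector_derivative[OF bounded_linear_Re v] .
  then show "(g has_real_derivative Re f') (at t)"
    by (simp add: has_real_derivative_iff_has_vector_derivative)
  have "((\<lambda>s. Im (complex_of_real (g s))) has_vector_derivative Im f') (at t)"
    using bounded_linear.has_vector_derivative[OF bounded_linear_Im v] .
  then have "((\<lambda>s. 0 :: real) has_vector_derivative Im f') (at t)" by simp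
  then show "Im f' = 0"
    by (rule vector_derivative_unique_at) simp
qed

lemma stake_in_lists: "x \<in> streams S \<Longrightarrow> stake n x \<in> lists S"
  by (induction n arbitrary: x) (auto simp: streams_shd streams_stl)

lemma sdrop_in_streams: "x \<in> streams S \<Longrightarrow> sdrop n x \<in> streams S"
  by (induction n arbitrary: x) (auto simp: streams_stl)

lemma words_SucE:
  assumes "\<omega> \<in> words d (Suc n)"
  obtains i \<alpha> where "\<omega> = i # \<alpha>" "i \<in> {1..d}" "\<alpha> \<in> words d n"
proof -
  obtain i \<alpha> where \<omega>: "\<omega> = i # \<alpha>" using assms by (cases \<omega>) (simp_all add: words_def)
  have "i \<in> {1..d}" "\<alpha> \<in> words d n" using assms unfolding \<omega> by (simp_all add: words_def)
  then show ?thesis using that \<omega> by blast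
qed

locale conformal_system =
  fixes d :: nat and \<Phi> :: ifs
  assumes in_CS: "\<Phi> \<in> CS d"
begin

abbreviation "X \<equiv> dom \<Phi>"
abbreviation "\<phi> \<equiv> gen \<Phi>"
abbreviation "\<phi>w \<equiv> foldr (gen \<Phi>)"
abbreviation "\<pi> \<equiv> coding_map \<Phi>"
abbreviation "\<Lambda> \<equiv> limit_set d \<Phi>"
abbreviation "I \<equiv> {1..d}"

lemma X_nonempty: "X \<noteq> {}" and X_connected: "connected X" and X_compact: "compact X"
  and inj_gen: "i \<in> I \<Longrightarrow> inj_on (\<phi> i) X"
  and gen_disjoint: "i \<in> I \<Longrightarrow> j \<in> I \<Longrightarrow> i \<noteq> j \<Longrightarrow> \<phi> i ` interior X \<inter> \<phi> j ` interior X = {}"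
  and distortion: "conformal_bounded_distortion d \<Phi>"
  using in_CS by (auto simp: CS_def)

lemma gen_interior: "i \<in> I \<Longrightarrow> x \<in> X \<Longrightarrow> \<phi> i x \<in> interior X"
  using in_CS by (fastforce simp: CS_def)

lemma gen_lipschitz: "i \<in> I \<Longrightarrow> \<exists>c<1. c-lipschitz_on X (\<phi> i)"
  using in_CS by (simp add: CS_def)

lemma gen_continuous: "i \<in> I \<Longrightarrow> continuous_on X (\<phi> i)"
  using gen_lipschitz lipschitz_on_continuous_on by blast

lemma interior_in_X: "x \<in> interior X \<Longrightarrow> x \<in> X"
  using interior_subset by blast

lemma word_in_X: "\<omega> \<in> lists I \<Longrightarrow> x \<in> X \<Longrightarrow> \<phi>w \<omega> x \<in> X"
proof (induction rule: lists.induct)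
  case (Cons i \<omega>)
  then show ?case using gen_interior[THEN interior_in_X] by simp
qed simp

lemma continuous_word: "\<omega> \<in> lists I \<Longrightarrow> continuous_on X (\<phi>w \<omega>)"
proof (induction rule: lists.induct)
  case Nil
  then show ?case by (simp add: id_def)
next
  case (Cons i \<omega>)
  have "continuous_on X (\<phi> i \<circ> \<phi>w \<omega>)"
    using Cons word_in_X
    by (intro continuous_on_compose continuous_on_subset[OF gen_continuous]) auto
  then show ?case by (simp add: o_def)
qed

lemma compact_word_image: "\<omega> \<in> lists I \<Longrightarrow> compact (\<phi>w \<omega> ` X)"
  by (intro compact_continuous_image continuous_word X_compact)

text \<open>
  There are finitely many generators, so the largest contraction factor serves all of them.
\<close>

lemma uniform_contraction:
  "\<exists>c\<ge>0. c < 1 \<and>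
    (\<forall>\<omega>\<in>lists I. \<forall>x\<in>X. \<forall>y\<in>X. \<bar>\<phi>w \<omega> x - \<phi>w \<omega> y\<bar> \<le> c ^ length \<omega> * \<bar>x - y\<bar>)"
proof -
  obtain c where c: "\<And>i. i \<in> I \<Longrightarrow> c i < 1 \<and> (c i)-lipschitz_on X (\<phi> i)"
    using gen_lipschitz by metis
  define m where "m = Max (insert 0 (c ` I))"
  have fin: "finite (insert 0 (c ` I))" by simp
  have m: "0 \<le> m" "\<And>i. i \<in> I \<Longrightarrow> c i \<le> m"
    unfolding m_def using Max_ge[OF fin] by (auto simp del: atLeastAtMost_iff)
  have m1: "m < 1" unfolding m_def using c by (simp del: atLeastAtMost_iff)
  have "\<bar>\<phi>w \<omega> x - \<phi>w \<omega> y\<bar> \<le> m ^ length \<omega> * \<bar>x - y\<bar>" if "\<omega> \<in> lists I" "x \<in> X" "y \<in> X" for \<omega> x y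
    using that
  proof (induction rule: lists.induct)
    case (Cons i \<omega>)
    have "\<bar>\<phi> i (\<phi>w \<omega> x) - \<phi> i (\<phi>w \<omega> y)\<bar> \<le> c i * \<bar>\<phi>w \<omega> x - \<phi>w \<omega> y\<bar>"
      using lipschitz_onD[of "c i" X "\<phi> i" "\<phi>w \<omega> x" "\<phi>w \<omega> y"] c Cons word_in_X by (simp add: dist_real_def)
    also have "\<dots> \<le> m * (m ^ length \<omega> * \<bar>x - y\<bar>)"
      using m Cons by (intro mult_mono) auto
    finally show ?case by (simp add: mult.assoc)
  qed simp
  then show ?thesis using m(1) m1 by blast
qed

lemma coding_exists:
  assumes x: "x \<in> streams I"
  shows "\<exists>y. (\<Inter>n. \<phi>w (stake n x) ` X) = {y}"
proof -
  let ?F = "\<lambda>n. \<phi>w (stake n x) ` X"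
  have step: "?F (Suc n) \<subseteq> ?F n" for n
    using gen_interior[OF snth_in[OF x, of n], THEN interior_in_X] by (auto simp: stake_Suc simp del: stake.simps)
  have "\<Inter>(range ?F) \<noteq> {}"
  proof (rule compact_nest)
    show "compact (?F n)" "?F n \<noteq> {}" for n
      using compact_word_image[OF stake_in_lists[OF x]] X_nonempty by simp_all
    show "?F n \<subseteq> ?F m" if "m \<le> n" for m n using step that by (rule lift_Suc_antimono_le)
  qed
  moreover have "a = b" if a: "a \<in> \<Inter>(range ?F)" and b: "b \<in> \<Inter>(range ?F)" for a b
  proof -
    obtain c where c: "0 \<le> c" "c < 1"
      "\<And>\<omega> x y. \<omega> \<in> lists I \<Longrightarrow> x \<in> X \<Longrightarrow> y \<in> X \<Longrightarrow> \<bar>\<phi>w \<omega> x - \<phi>w \<omega> y\<bar> \<le> c ^ length \<omega> * \<bar>x - y\<bar>"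
      using uniform_contraction by blast
    obtain K where K: "\<And>y. y \<in> X \<Longrightarrow> \<bar>y\<bar> \<le> K"
      using compact_imp_bounded[OF X_compact] unfolding bounded_iff by auto
    have "\<bar>a - b\<bar> \<le> c ^ n * (2 * K)" for n
    proof -
      obtain a' b' where ab: "a' \<in> X" "b' \<in> X" "a = \<phi>w (stake n x) a'" "b = \<phi>w (stake n x) b'"
        using a b by blast
      have "\<bar>a - b\<bar> \<le> c ^ n * \<bar>a' - b'\<bar>"
        using c(3)[OF stake_in_lists[OF x] ab(1,2), of n] ab by simp
      also have "\<dots> \<le> c ^ n * (2 * K)"
        using K[OF ab(1)] K[OF ab(2)] c(1) by (intro mult_left_mono) auto
      finally show ?thesis .
    qed
    moreover have "(\<lambda>n. c ^ n * (2 * K)) \<longlonglongrightarrow> 0 * (2 * K)"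
      using c by (intro tendsto_mult_right LIMSEQ_realpow_zero)
    ultimately have "\<bar>a - b\<bar> \<le> 0" by (intro LIMSEQ_le_const) auto
    then show ?thesis by simp
  qed
  ultimately show ?thesis by blast
qed

lemma coding_Inter:
  assumes x: "x \<in> streams I"
  shows "(\<Inter>n. \<phi>w (stake n x) ` X) = {\<pi> x}"
proof -
  obtain y where y: "(\<Inter>n. \<phi>w (stake n x) ` X) = {y}" using coding_exists[OF x] by blast
  have "\<pi> x = y" unfolding coding_map_def y by (rule the_equality) auto
  then show ?thesis using y by simp
qed

lemma coding_in:
  assumes x: "x \<in> streams I"
  shows "\<pi> x \<in> \<phi>w (stake n x) ` X"
proof -
  have "\<pi> x \<in> (\<Inter>n. \<phi>w (stake n x) ` X)" unfolding coding_Inter[OF x] by simp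
  then show ?thesis by (rule INT_D[OF _ UNIV_I])
qed

lemma coding_eqI:
  assumes x: "x \<in> streams I" and y: "\<And>n. y \<in> \<phi>w (stake n x) ` X"
  shows "\<pi> x = y"
proof -
  have "y \<in> (\<Inter>n. \<phi>w (stake n x) ` X)" by (rule INT_I) (rule y)
  then show ?thesis unfolding coding_Inter[OF x] by simp
qed

lemma coding_step:
  assumes x: "x \<in> streams I"
  shows "\<pi> x = \<phi> (shd x) (\<pi> (stl x))"
proof (rule coding_eqI[OF x])
  fix n
  have i: "shd x \<in> I" and sx: "stl x \<in> streams I" using x streams_shd streams_stl by blast+
  show "\<phi> (shd x) (\<pi> (stl x)) \<in> \<phi>w (stake n x) ` X"
  proof (cases n)
    case 0
    have "\<pi> (stl x) \<in> X" using coding_in[OF sx, of 0] by simp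
    then show ?thesis using 0 gen_interior[OF i, THEN interior_in_X] by simp
  next
    case (Suc m)
    then show ?thesis using coding_in[OF sx, of m] by auto
  qed
qed

lemma coding_in_X: "x \<in> streams I \<Longrightarrow> \<pi> x \<in> X"
  using coding_in[of x 0] by (simp del: atLeastAtMost_iff)

lemma coding_interior:
  assumes x: "x \<in> streams I"
  shows "\<pi> x \<in> interior X"
  unfolding coding_step[OF x] by (rule gen_interior[OF streams_shd[OF x] coding_in_X[OF streams_stl[OF x]]])

lemma coding_Stream: "i \<in> I \<Longrightarrow> x \<in> streams I \<Longrightarrow> \<pi> (i ## x) = \<phi> i (\<pi> x)"
  using coding_step[of "i ## x"] unfolding streams_Stream by simp

lemma coding_stake: "x \<in> streams I \<Longrightarrow> \<pi> x = \<phi>w (stake n x) (\<pi> (sdrop n x))"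
proof (induction n arbitrary: x)
  case (Suc n)
  have "\<pi> x = \<phi> (shd x) (\<pi> (stl x))" by (rule coding_step[OF Suc.prems])
  also have "\<pi> (stl x) = \<phi>w (stake n (stl x)) (\<pi> (sdrop n (stl x)))"
    by (rule Suc.IH[OF streams_stl[OF Suc.prems]])
  finally show ?case by simp
qed simp

text \<open>
  For every \<open>n\<close> the point \<open>y\<close> lies in some \<open>\<phi> i ` \<phi>w \<omega> ` X\<close> with \<open>\<omega>\<close> of length \<open>n\<close>, but \<open>i\<close> and \<open>\<omega>\<close> might depend on
  \<open>n\<close>.  However, as soon as \<open>n \<ge> 1\<close> the preimage lies in the interior of \<open>X\<close>, and the images
  of the interior under different generators are disjoint, so \<open>i\<close> and the preimage are the same for all \<open>n\<close>.
\<close>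

lemma limit_set_preimage:
  assumes y: "y \<in> \<Lambda>"
  shows "\<exists>i\<in>I. \<exists>z\<in>\<Lambda>. y = \<phi> i z"
proof -
  have level: "\<exists>i\<in>I. \<exists>\<omega>\<in>words d n. \<exists>z\<in>\<phi>w \<omega> ` X. y = \<phi> i z" for n
  proof -
    have "y \<in> (\<Union>\<omega>\<in>words d (Suc n). \<phi>w \<omega> ` X)" using y by (auto simp: limit_set_def)
    then obtain \<omega> where "\<omega> \<in> words d (Suc n)" "y \<in> \<phi>w \<omega> ` X" by blast
    then obtain x where x: "x \<in> X" "y = \<phi>w \<omega> x" by blast
    obtain i \<alpha> where "\<omega> = i # \<alpha>" "i \<in> I" "\<alpha> \<in> words d n"
      using \<open>\<omega> \<in> words d (Suc n)\<close> by (rule words_SucE)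
    then show ?thesis using x by (intro bexI[of _ i] bexI[of _ \<alpha>] bexI[of _ "\<phi>w \<alpha> x"]) simp_all
  qed
  have int: "\<phi>w \<omega> x \<in> interior X" if "\<omega> \<in> words d (Suc n)" "x \<in> X" for \<omega> n x
    using that(1)
  proof (rule words_SucE)
    fix i \<alpha> assume "\<omega> = i # \<alpha>" and i: "i \<in> I" and \<alpha>: "\<alpha> \<in> words d n"
    then show ?thesis using gen_interior[OF i word_in_X[OF words_in_lists[OF \<alpha>] that(2)]] by simp
  qed
  obtain i \<omega> z where i: "i \<in> I" and w: "\<omega> \<in> words d (Suc 0)" "z \<in> \<phi>w \<omega> ` X" and yz: "y = \<phi> i z"
    using level[of "Suc 0"] by blast
  have z: "z \<in> interior X" using int w by blast
  have "z \<in> (\<Union>\<omega>\<in>words d n. \<phi>w \<omega> ` X)" for n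
  proof (cases n)
    case 0
    then show ?thesis using z interior_in_X by simp
  next
    case (Suc m)
    obtain j \<omega>' z' where j: "j \<in> I" and w': "\<omega>' \<in> words d n" "z' \<in> \<phi>w \<omega>' ` X" and yz': "y = \<phi> j z'"
      using level[of n] by blast
    have z': "z' \<in> interior X" using int w' Suc by blast
    have "y \<in> \<phi> i ` interior X \<inter> \<phi> j ` interior X"
      using imageI[OF z, of "\<phi> i"] imageI[OF z', of "\<phi> j"] yz yz' by simp
    then have "i = j" using gen_disjoint[OF i j] by (cases "i = j") simp_all
    then have "\<phi> i z = \<phi> i z'" using yz yz' by simp
    then have "z = z'" using inj_onD[OF inj_gen[OF i]] interior_in_X[OF z] interior_in_X[OF z'] by blast
    then show ?thesis using w' by blast
  qed
  then have "z \<in> \<Lambda>" by (simp add: limit_set_def)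
  then show ?thesis using i yz by blast
qed

text \<open>
  Taking preimages within the limit set again and again reads off a code of a given point.
\<close>

lemma limit_set_eq_coding: "\<Lambda> = \<pi> ` streams I"
proof (intro equalityI subsetI)
  fix y assume "y \<in> \<pi> ` streams I"
  then obtain x where x: "x \<in> streams I" and y: "y = \<pi> x" by blast
  have "stake n x \<in> words d n" for n using stake_in_lists[OF x] by (simp add: words_def)
  then show "y \<in> \<Lambda>" unfolding limit_set_def using coding_in[OF x] y by blast
next
  fix y assume y: "y \<in> \<Lambda>"
  obtain f g where fg: "\<And>y. y \<in> \<Lambda> \<Longrightarrow> f y \<in> I \<and> g y \<in> \<Lambda> \<and> y = \<phi> (f y) (g y)"
    using limit_set_preimage by metis
  define code where "code = (\<lambda>y. smap f (siterate g y))"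
  have code: "shd (code y) = f y" "stl (code y) = code (g y)" for y
    by (simp_all add: code_def)
  have orbit: "(g ^^ n) y \<in> \<Lambda>" if "y \<in> \<Lambda>" for n y
    using that fg by (induction n) simp_all
  have streams: "code y \<in> streams I" if "y \<in> \<Lambda>" for y
    unfolding streams_iff_snth code_def using fg[OF orbit[OF that]] by simp
  have X: "y \<in> X" if "y \<in> \<Lambda>" for y
    using that by (auto simp: limit_set_def dest: spec[of _ 0])
  have "y \<in> \<phi>w (stake n (code y)) ` X" if "y \<in> \<Lambda>" for n y
    using that
  proof (induction n arbitrary: y)
    case 0
    then show ?case using X by simp
  next
    case (Suc n)
    then have "\<phi> (f y) (g y) \<in> \<phi> (f y) ` \<phi>w (stake n (code (g y))) ` X" using fg by blast
    then show ?case using fg[OF Suc.prems] by (auto simp: code image_image)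
  qed
  then have "\<pi> (code y) = y" using coding_eqI[OF streams[OF y]] y by blast
  then show "y \<in> \<pi> ` streams I" using streams[OF y] by (metis imageI)
qed

lemma limit_set_interior: "\<Lambda> \<subseteq> interior X"
  unfolding limit_set_eq_coding by (rule image_subsetI) (rule coding_interior)

lemma gen_limit_set:
  assumes i: "i \<in> I" and y: "y \<in> \<Lambda>"
  shows "\<phi> i y \<in> \<Lambda>"
proof -
  obtain x where x: "x \<in> streams I" "y = \<pi> x" using y unfolding limit_set_eq_coding by (rule imageE)
  have "i ## x \<in> streams I" using i x(1) unfolding streams_Stream by (rule conjI)
  then have "\<pi> (i ## x) \<in> \<Lambda>" unfolding limit_set_eq_coding by (rule imageI)
  then show ?thesis by (simp only: coding_Stream[OF i x(1)] x(2))
qed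

lemma word_limit_set: "\<omega> \<in> lists I \<Longrightarrow> y \<in> \<Lambda> \<Longrightarrow> \<phi>w \<omega> y \<in> \<Lambda>"
proof (induction rule: lists.induct)
  case (Cons i \<omega>)
  then show ?case using gen_limit_set by simp
qed simp

text \<open>
  Codes with different first letters give different points; this is where two generators are needed.
\<close>

lemma limit_set_two_points:
  assumes "d \<ge> 2"
  obtains \<xi> \<eta> where "\<xi> \<in> \<Lambda>" "\<eta> \<in> \<Lambda>" "\<xi> \<noteq> \<eta>"
proof -
  have I: "1 \<in> I" "2 \<in> I" using assms by auto
  then have "streams I \<noteq> {}" unfolding streams_empty_iff by auto
  then obtain x where x: "x \<in> streams I" by blast
  have in_\<Lambda>: "\<phi> 1 (\<pi> x) \<in> \<Lambda>" "\<phi> 2 (\<pi> x) \<in> \<Lambda>"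
    using x I gen_limit_set unfolding limit_set_eq_coding by blast+
  have "\<phi> 1 (\<pi> x) \<noteq> \<phi> 2 (\<pi> x)"
  proof
    assume eq: "\<phi> 1 (\<pi> x) = \<phi> 2 (\<pi> x)"
    have "\<phi> 1 (\<pi> x) \<in> \<phi> 1 ` interior X \<inter> \<phi> 2 ` interior X"
      using coding_interior[OF x] by (intro IntI imageI) (simp_all only: eq imageI)
    then show False using gen_disjoint[OF I] by simp
  qed
  then show ?thesis using that in_\<Lambda> by blast
qed

end

section \<open>Bounded distortion\<close>

context conformal_system
begin

lemma interior_X_convex: "convex (interior X)"
  using X_connected by (intro convex_interior) (simp add: convex_real_interval flip: is_interval_connected_1 is_interval_convex_1)

text \<open>
  The chain rule along \<open>x\<close> identifies \<open>exp (S\<^sub>n I\<^sub>\<Phi> x)\<close> with \<open>\<bar>\<phi>\<^sub>\<omega>'\<bar>\<close> at the point coded by the tail of \<open>x\<close>, and the mean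
  value theorem identifies \<open>\<bar>\<phi>\<^sub>\<omega> \<xi> - \<phi>\<^sub>\<omega> \<eta>\<bar> / \<bar>\<xi> - \<eta>\<bar>\<close> with \<open>\<bar>\<phi>\<^sub>\<omega>'\<bar>\<close> at some other point.  Bounded distortion makes
  these comparable.  The distance \<open>\<bar>\<phi>\<^sub>\<omega> \<xi> - \<phi>\<^sub>\<omega> \<eta>\<bar>\<close> involves no derivatives, so a bi-Lipschitz map changes
  it only by a bounded factor.
\<close>

lemma birkhoff_sum_comparable:
  assumes \<xi>: "\<xi> \<in> \<Lambda>" and \<eta>: "\<eta> \<in> \<Lambda>" and neq: "\<xi> \<noteq> \<eta>"
  shows "\<exists>D. \<forall>\<omega>\<in>lists I. \<forall>x\<in>sstart I \<omega>.
    \<bar>birkhoff_sum (geometric_potential \<Phi>) (length \<omega>) x - ln \<bar>\<phi>w \<omega> \<xi> - \<phi>w \<omega> \<eta>\<bar>\<bar> \<le> D"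
proof -
  obtain U F where UF: "open U \<and> connected U \<and> complex_of_real ` X \<subseteq> U \<and>
        (\<forall>i\<in>I. F i holomorphic_on U \<and> (\<forall>z\<in>U. deriv (F i) z \<noteq> 0) \<and> F i ` U \<subseteq> U \<and>
           (\<forall>x\<in>X. F i (complex_of_real x) = complex_of_real (\<phi> i x))) \<and>
        (\<exists>C\<ge>1. \<forall>\<omega>\<in>lists I. \<forall>x\<in>U. \<forall>y\<in>U.
           cmod (deriv (foldr F \<omega>) y) \<le> C * cmod (deriv (foldr F \<omega>) x))"
    using distortion unfolding conformal_bounded_distortion_def by (elim exE) (rule that)
  have U: "open U" "complex_of_real ` X \<subseteq> U"
    using UF by - (elim conjE, assumption)+
  have F: "F i holomorphic_on U \<and> (\<forall>z\<in>U. deriv (F i) z \<noteq> 0) \<and> F i ` U \<subseteq> U \<and>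
           (\<forall>x\<in>X. F i (complex_of_real x) = complex_of_real (\<phi> i x))" if "i \<in> I" for i
    using UF that by (elim conjE) (drule (1) bspec, assumption)
  have "\<exists>C\<ge>1. \<forall>\<omega>\<in>lists I. \<forall>x\<in>U. \<forall>y\<in>U. cmod (deriv (foldr F \<omega>) y) \<le> C * cmod (deriv (foldr F \<omega>) x)"
    using UF by (elim conjE) assumption
  then obtain C where C1: "C \<ge> 1"
    and C2: "\<forall>\<omega>\<in>lists I. \<forall>x\<in>U. \<forall>y\<in>U. cmod (deriv (foldr F \<omega>) y) \<le> C * cmod (deriv (foldr F \<omega>) x)"
    by (elim exE conjE) (rule that)
  have C: "C \<ge> 1" "\<And>\<omega> x y. \<omega> \<in> lists I \<Longrightarrow> x \<in> U \<Longrightarrow> y \<in> U \<Longrightarrow>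
           cmod (deriv (foldr F \<omega>) y) \<le> C * cmod (deriv (foldr F \<omega>) x)"
    using C1 C2 by simp_all
  have XU: "of_real t \<in> U" if "t \<in> interior X" for t
    using U(2) interior_in_X[OF that] by blast
  have FU: "foldr F \<omega> z \<in> U" if "\<omega> \<in> lists I" "z \<in> U" for \<omega> z
    using that
  proof (induction rule: lists.induct)
    case (Cons i \<omega>)
    then show ?case using F[OF Cons.hyps(1)] by auto
  qed simp
  have hol: "foldr F \<omega> holomorphic_on U" if "\<omega> \<in> lists I" for \<omega>
    using that
  proof (induction rule: lists.induct)
    case Nil
    then show ?case by (simp add: id_def)
  next
    case (Cons i \<omega>)
    have "(F i \<circ> foldr F \<omega>) holomorphic_on U"
      using F[OF Cons.hyps(1)] FU[OF Cons.hyps(2)]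
      by (intro holomorphic_on_compose_gen[OF Cons.IH]) auto
    then show ?case by (simp add: o_def)
  qed
  have ext: "foldr F \<omega> (of_real t) = of_real (\<phi>w \<omega> t)" if "\<omega> \<in> lists I" "t \<in> X" for \<omega> t
    using that
  proof (induction rule: lists.induct)
    case (Cons i \<omega>)
    then show ?case using F[OF Cons.hyps(1)] word_in_X[OF Cons.hyps(2)] by simp
  qed simp
  have real_deriv: "(\<phi>w \<omega> has_real_derivative Re (deriv (foldr F \<omega>) (of_real t))) (at t)"
      "\<bar>Re (deriv (foldr F \<omega>) (of_real t))\<bar> = cmod (deriv (foldr F \<omega>) (of_real t))"
    if w: "\<omega> \<in> lists I" and t: "t \<in> interior X" for \<omega> t
  proof -
    have d: "(foldr F \<omega> has_field_derivative deriv (foldr F \<omega>) (of_real t)) (at (of_real t))"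
      by (rule holomorphic_derivI[OF hol[OF w] U(1) XU[OF t]])
    have e: "foldr F \<omega> (of_real s) = of_real (\<phi>w \<omega> s)" if "s \<in> interior X" for s
      by (rule ext[OF w interior_in_X[OF that]])
    note * = real_derivative_of_complex_extension[OF d open_interior t e]
    show "(\<phi>w \<omega> has_real_derivative Re (deriv (foldr F \<omega>) (of_real t))) (at t)" by (rule *(1))
    show "\<bar>Re (deriv (foldr F \<omega>) (of_real t))\<bar> = cmod (deriv (foldr F \<omega>) (of_real t))"
      using *(2) by (simp add: cmod_eq_Re)
  qed
  have chain: "deriv (foldr F (i # \<omega>)) z = deriv (F i) (foldr F \<omega> z) * deriv (foldr F \<omega>) z"
    if i: "i \<in> I" and w: "\<omega> \<in> lists I" and z: "z \<in> U" for i \<omega> z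
  proof -
    have "deriv (F i \<circ> foldr F \<omega>) z = deriv (F i) (foldr F \<omega> z) * deriv (foldr F \<omega>) z"
    proof (rule deriv_chain)
      show "foldr F \<omega> field_differentiable at z"
        by (rule holomorphic_on_imp_differentiable_at[OF hol[OF w] U(1) z])
      show "F i field_differentiable at (foldr F \<omega> z)"
        using F[OF i] by (intro holomorphic_on_imp_differentiable_at[OF _ U(1) FU[OF w z]]) blast
    qed
    then show ?thesis by (simp add: o_def)
  qed
  have nz: "deriv (foldr F \<omega>) z \<noteq> 0" if "\<omega> \<in> lists I" "z \<in> U" for \<omega> z
    using that
  proof (induction rule: lists.induct)
    case Nil
    then show ?case by (simp add: id_def)
  next
    case (Cons i \<omega>)
    have "deriv (F i) (foldr F \<omega> z) \<noteq> 0"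
      using F[OF Cons.hyps(1)] FU[OF Cons.hyps(2) Cons.prems] by blast
    then show ?case unfolding chain[OF Cons.hyps Cons.prems] using Cons.IH[OF Cons.prems] by simp
  qed
  have birkhoff: "birkhoff_sum (geometric_potential \<Phi>) n x
      = ln (cmod (deriv (foldr F (stake n x)) (of_real (\<pi> (sdrop n x)))))" if "x \<in> streams I" for n x
    using that
  proof (induction n arbitrary: x)
    case 0
    then show ?case by (simp add: birkhoff_sum_def id_def)
  next
    case (Suc n)
    have i: "shd x \<in> I" and sx: "stl x \<in> streams I"
      using streams_shd[OF Suc.prems] streams_stl[OF Suc.prems] .
    let ?\<omega> = "stake n (stl x)" and ?t = "\<pi> (sdrop n (stl x))"
    have w: "?\<omega> \<in> lists I" by (rule stake_in_lists[OF sx])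
    have t: "?t \<in> interior X" by (rule coding_interior[OF sdrop_in_streams[OF sx]])
    have p: "\<pi> (stl x) = \<phi>w ?\<omega> ?t" by (rule coding_stake[OF sx])
    have pi: "\<pi> (stl x) \<in> interior X" by (rule coding_interior[OF sx])
    have i1: "[shd x] \<in> lists I" using i by simp
    have "(\<phi> (shd x) has_real_derivative Re (deriv (F (shd x)) (of_real (\<pi> (stl x))))) (at (\<pi> (stl x)))"
      using real_deriv(1)[OF i1 pi] by simp
    then have "\<bar>deriv (\<phi> (shd x)) (\<pi> (stl x))\<bar> = cmod (deriv (F (shd x)) (of_real (\<pi> (stl x))))"
      using real_deriv(2)[OF i1 pi] by (simp add: DERIV_imp_deriv)
    then have g: "geometric_potential \<Phi> x = ln (cmod (deriv (F (shd x)) (foldr F ?\<omega> (of_real ?t))))"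
      unfolding geometric_potential_def by (simp only: p ext[OF w interior_in_X[OF t]])
    have "birkhoff_sum (geometric_potential \<Phi>) (Suc n) x
        = geometric_potential \<Phi> x + birkhoff_sum (geometric_potential \<Phi>) n (stl x)"
      unfolding birkhoff_sum_def sum.lessThan_Suc_shift by simp
    also have "\<dots> = ln (cmod (deriv (F (shd x)) (foldr F ?\<omega> (of_real ?t))))
        + ln (cmod (deriv (foldr F ?\<omega>) (of_real ?t)))"
      by (simp only: g Suc.IH[OF sx])
    also have "\<dots> = ln (cmod (deriv (F (shd x)) (foldr F ?\<omega> (of_real ?t)))
        * cmod (deriv (foldr F ?\<omega>) (of_real ?t)))"
    proof -
      have "deriv (F (shd x)) (foldr F ?\<omega> (of_real ?t)) \<noteq> 0" using F[OF i] FU[OF w XU[OF t]] by blast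
      then show ?thesis using nz[OF w XU[OF t]] by (simp add: ln_mult)
    qed
    also have "\<dots> = ln (cmod (deriv (foldr F (shd x # ?\<omega>)) (of_real ?t)))"
      by (simp only: chain[OF i w XU[OF t]] norm_mult)
    finally show ?case by (simp only: stake.simps sdrop.simps)
  qed
  have mean_value: "\<exists>\<zeta>\<in>interior X. \<bar>\<phi>w \<omega> b - \<phi>w \<omega> a\<bar> = \<bar>b - a\<bar> * cmod (deriv (foldr F \<omega>) (of_real \<zeta>))"
    if w: "\<omega> \<in> lists I" and a: "a \<in> interior X" and b: "b \<in> interior X" and "a < b" for \<omega> a b
  proof -
    have "closed_segment a b \<subseteq> interior X" by (rule closed_segment_subset[OF a b interior_X_convex])
    then have seg: "x \<in> interior X" if "a \<le> x" "x \<le> b" for x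
      using that \<open>a < b\<close> by (auto simp: closed_segment_eq_real_ivl subset_iff)
    have "\<exists>\<zeta>>a. \<zeta> < b \<and> \<phi>w \<omega> b - \<phi>w \<omega> a = (b - a) * Re (deriv (foldr F \<omega>) (of_real \<zeta>))"
      by (rule MVT2[OF \<open>a < b\<close>]) (rule real_deriv(1)[OF w seg])
    then obtain \<zeta> where z: "a < \<zeta>" "\<zeta> < b"
      and eq: "\<phi>w \<omega> b - \<phi>w \<omega> a = (b - a) * Re (deriv (foldr F \<omega>) (of_real \<zeta>))" by blast
    have "\<zeta> \<in> interior X" using seg z by simp
    then show ?thesis using real_deriv(2)[OF w] eq by (intro bexI[of _ \<zeta>]) (simp add: abs_mult)
  qed
  have "\<bar>birkhoff_sum (geometric_potential \<Phi>) (length \<omega>) x - ln \<bar>\<phi>w \<omega> \<xi> - \<phi>w \<omega> \<eta>\<bar>\<bar>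
      \<le> ln C + \<bar>ln \<bar>\<xi> - \<eta>\<bar>\<bar>" if w: "\<omega> \<in> lists I" and x: "x \<in> sstart I \<omega>" for \<omega> x
  proof -
    have "\<xi> \<in> interior X" "\<eta> \<in> interior X" using \<xi> \<eta> limit_set_interior by blast+
    then obtain \<zeta> where z: "\<zeta> \<in> interior X"
      and mv: "\<bar>\<phi>w \<omega> \<xi> - \<phi>w \<omega> \<eta>\<bar> = \<bar>\<xi> - \<eta>\<bar> * cmod (deriv (foldr F \<omega>) (of_real \<zeta>))"
      using mean_value[OF w, of \<xi> \<eta>] mean_value[OF w, of \<eta> \<xi>] neq
      by (metis abs_minus_commute linorder_neq_iff)
    have xs: "x \<in> streams I" using sstart_in_streams[OF w] x by blast
    have "stake (length \<omega>) x = \<omega>"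
      using x w by (intro nth_equalityI) (simp_all add: sstart_eq[OF xs])
    moreover define y where "y = \<pi> (sdrop (length \<omega>) x)"
    ultimately have B: "birkhoff_sum (geometric_potential \<Phi>) (length \<omega>) x = ln (cmod (deriv (foldr F \<omega>) (of_real y)))"
      using birkhoff[OF xs, of "length \<omega>"] by simp
    have y: "y \<in> interior X" unfolding y_def by (rule coding_interior[OF sdrop_in_streams[OF xs]])
    define A where "A = cmod (deriv (foldr F \<omega>) (of_real y))"
    define E where "E = cmod (deriv (foldr F \<omega>) (of_real \<zeta>))"
    have AE: "0 < A" "0 < E" using nz[OF w XU] y z by (simp_all add: A_def E_def)
    have "A \<le> C * E" "E \<le> C * A" unfolding A_def E_def by (intro C(2)[OF w] XU y z)+
    then have "ln A \<le> ln (C * E)" "ln E \<le> ln (C * A)" using AE by simp_all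
    then have "ln A \<le> ln C + ln E" "ln E \<le> ln C + ln A" using AE C(1) by (simp_all add: ln_mult)
    moreover have "ln \<bar>\<phi>w \<omega> \<xi> - \<phi>w \<omega> \<eta>\<bar> = ln \<bar>\<xi> - \<eta>\<bar> + ln E"
      unfolding mv E_def[symmetric] using neq AE by (simp add: ln_mult)
    ultimately show ?thesis unfolding B A_def[symmetric] by linarith
  qed
  then show ?thesis by blast
qed

lemma X_two_points:
  assumes "i \<in> I"
  obtains x y where "x \<in> X" "y \<in> X" "x \<noteq> y"
proof -
  obtain x0 where "x0 \<in> X" using X_nonempty by blast
  then have "\<phi> i x0 \<in> interior X" by (rule gen_interior[OF assms])
  then obtain e where "e > 0" "cball (\<phi> i x0) e \<subseteq> X" unfolding mem_interior_cball by blast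
  then have "\<phi> i x0 \<in> X" "\<phi> i x0 + e \<in> X" by (auto simp: subset_iff dist_real_def)
  then show ?thesis using that \<open>e > 0\<close> by (metis add_cancel_right_right less_irrefl)
qed

text \<open>
  The images of \<open>X\<close> under two generators may share an endpoint.  The second level images \<open>\<phi> i ` \<phi> j ` X\<close> are
  compact subsets of the disjoint sets \<open>\<phi> i ` interior X\<close>, hence those with different \<open>i\<close> have positive
  distance.
\<close>

lemma coding_separation:
  "\<exists>\<delta>>0. \<forall>x\<in>streams I. \<forall>y\<in>streams I. shd x \<noteq> shd y \<longrightarrow> \<delta> \<le> \<bar>\<pi> x - \<pi> y\<bar>"
proof -
  define K where "K = (\<lambda>i. \<phi> i ` (\<Union>j\<in>I. \<phi> j ` X))"
  have sub: "(\<Union>j\<in>I. \<phi> j ` X) \<subseteq> interior X" using gen_interior by blast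
  have compact: "compact (K i)" if "i \<in> I" for i
    unfolding K_def
  proof (rule compact_continuous_image)
    show "continuous_on (\<Union>j\<in>I. \<phi> j ` X) (\<phi> i)"
      using continuous_on_subset[OF gen_continuous[OF that]] sub interior_subset[of X] by blast
    show "compact (\<Union>j\<in>I. \<phi> j ` X)"
      by (intro compact_UN compact_continuous_image gen_continuous X_compact) auto
  qed
  have K: "\<pi> x \<in> K (shd x)" if x: "x \<in> streams I" for x
  proof -
    have x': "stl x \<in> streams I" by (rule streams_stl[OF x])
    have "\<pi> (stl x) \<in> \<phi> (shd (stl x)) ` X"
      unfolding coding_step[OF x'] by (intro imageI coding_in_X streams_stl[OF x'])
    then show ?thesis
      unfolding K_def coding_step[OF x] using streams_shd[OF x'] by (intro imageI UN_I)
  qed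
  define P where "P = {(i, j). i \<in> I \<and> j \<in> I \<and> i \<noteq> j}"
  have "P \<subseteq> I \<times> I" by (auto simp: P_def)
  then have finP: "finite P" by (rule finite_subset) simp
  have "\<exists>\<delta>>0. \<forall>x\<in>K (fst ij). \<forall>y\<in>K (snd ij). \<delta> \<le> dist x y" if "ij \<in> P" for ij
  proof -
    obtain i j where ij: "ij = (i, j)" "i \<in> I" "j \<in> I" "i \<noteq> j" using \<open>ij \<in> P\<close> by (auto simp: P_def)
    have "K i \<inter> K j \<subseteq> \<phi> i ` interior X \<inter> \<phi> j ` interior X" unfolding K_def using sub by blast
    then have "K i \<inter> K j = {}" using gen_disjoint[OF ij(2,3,4)] by simp
    then show ?thesis
      using separate_compact_closed[OF compact[OF ij(2)] compact_imp_closed[OF compact[OF ij(3)]]]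
      by (simp add: ij(1))
  qed
  then obtain f where f: "\<And>ij. ij \<in> P \<Longrightarrow> 0 < f ij \<and> (\<forall>x\<in>K (fst ij). \<forall>y\<in>K (snd ij). f ij \<le> dist x y)"
    by metis
  define \<delta> where "\<delta> = Min (insert 1 (f ` P))"
  have "\<delta> > 0" unfolding \<delta>_def using finP f by simp
  moreover have "\<delta> \<le> \<bar>\<pi> x - \<pi> y\<bar>" if x: "x \<in> streams I" and y: "y \<in> streams I" and neq: "shd x \<noteq> shd y" for x y
  proof -
    have P: "(shd x, shd y) \<in> P" using streams_shd[OF x] streams_shd[OF y] neq by (simp add: P_def)
    have "\<delta> \<le> f (shd x, shd y)" unfolding \<delta>_def using finP P by (intro Min_le) auto
    also have "\<dots> \<le> dist (\<pi> x) (\<pi> y)" using f[OF P] K[OF x] K[OF y] by simp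
    finally show ?thesis by (simp add: dist_real_def)
  qed
  ultimately show ?thesis by blast
qed

end

section \<open>Affine systems\<close>

definition has_slopes :: "nat \<Rightarrow> ifs \<Rightarrow> (nat \<Rightarrow> real) \<Rightarrow> bool" where
  "has_slopes d \<Phi> a \<longleftrightarrow> (\<forall>i\<in>{1..d}. \<exists>b. \<forall>x\<in>dom \<Phi>. gen \<Phi> i x = a i * x + b)"

lemma AS_iff_has_slopes: "\<Phi> \<in> AS d \<longleftrightarrow> \<Phi> \<in> CS d \<and> (\<exists>a. has_slopes d \<Phi> a)"
proof -
  have "(\<forall>i\<in>{1..d}. \<exists>a b. \<forall>x\<in>dom \<Phi>. gen \<Phi> i x = a * x + b) \<longleftrightarrow> (\<exists>a. has_slopes d \<Phi> a)"
    unfolding has_slopes_def by (rule bchoice_iff)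
  then show ?thesis by (simp only: AS_def mem_Collect_eq)
qed

locale affine_system = conformal_system +
  fixes a :: "nat \<Rightarrow> real"
  assumes slopes: "has_slopes d \<Phi> a"
begin

lemma slope_difference:
  assumes "i \<in> I" "x \<in> X" "y \<in> X"
  shows "\<phi> i x - \<phi> i y = a i * (x - y)"
proof -
  obtain b where "\<forall>x\<in>X. \<phi> i x = a i * x + b" using slopes assms(1) unfolding has_slopes_def by blast
  then show ?thesis using assms by (simp add: right_diff_distrib)
qed

lemma slope_nonzero:
  assumes i: "i \<in> I"
  shows "a i \<noteq> 0"
proof
  assume "a i = 0"
  obtain x y where xy: "x \<in> X" "y \<in> X" "x \<noteq> y" using i by (rule X_two_points)
  have "\<phi> i x = \<phi> i y" using slope_difference[OF i xy(1,2)] \<open>a i = 0\<close> by simp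
  then show False using inj_onD[OF inj_gen[OF i] _ xy(1,2)] xy(3) by blast
qed

lemma word_difference:
  "\<omega> \<in> lists I \<Longrightarrow> x \<in> X \<Longrightarrow> y \<in> X \<Longrightarrow> \<bar>\<phi>w \<omega> x - \<phi>w \<omega> y\<bar> = weight (\<lambda>i. \<bar>a i\<bar>) \<omega> * \<bar>x - y\<bar>"
proof (induction rule: lists.induct)
  case (Cons i \<omega>)
  then show ?case
    using slope_difference[OF Cons.hyps(1) word_in_X[OF Cons.hyps(2) Cons.prems(1)] word_in_X[OF Cons.hyps(2) Cons.prems(2)]]
    by (simp add: abs_mult)
qed simp

text \<open>
  Prepending a common prefix to two codes scales the distance of the coded points exactly by the weight of
  that prefix.  Without it the codes differ in the first letter, and the distance of two such points is bounded above and below.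
\<close>

lemma coding_difference:
  "\<exists>\<delta>>0. \<exists>M>0. \<forall>x\<in>streams I. \<forall>y\<in>streams I. \<forall>n. stake n x = stake n y \<and> x !! n \<noteq> y !! n \<longrightarrow>
    weight (\<lambda>i. \<bar>a i\<bar>) (stake n x) * \<delta> \<le> \<bar>\<pi> x - \<pi> y\<bar> \<and>
    \<bar>\<pi> x - \<pi> y\<bar> \<le> weight (\<lambda>i. \<bar>a i\<bar>) (stake n x) * M"
proof -
  obtain \<delta> where \<delta>: "\<delta> > 0"
    "\<And>x y. x \<in> streams I \<Longrightarrow> y \<in> streams I \<Longrightarrow> shd x \<noteq> shd y \<Longrightarrow> \<delta> \<le> \<bar>\<pi> x - \<pi> y\<bar>"
    using coding_separation by blast
  obtain K where K: "\<And>y. y \<in> X \<Longrightarrow> \<bar>y\<bar> \<le> K"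
    using compact_imp_bounded[OF X_compact] unfolding bounded_iff by auto
  have M: "0 < 2 * \<bar>K\<bar> + 1" by simp
  show ?thesis
  proof (intro exI conjI ballI allI impI, rule \<delta>(1), rule M, goal_cases)
    case (1 x y n)
    then have xn: "sdrop n x \<in> streams I" "sdrop n y \<in> streams I" using sdrop_in_streams by blast+
    have w: "stake n x \<in> lists I" by (rule stake_in_lists[OF 1(1)])
    have eq: "\<bar>\<pi> x - \<pi> y\<bar> = weight (\<lambda>i. \<bar>a i\<bar>) (stake n x) * \<bar>\<pi> (sdrop n x) - \<pi> (sdrop n y)\<bar>"
      using word_difference[OF w coding_in_X[OF xn(1)] coding_in_X[OF xn(2)]]
        coding_stake[OF 1(1), of n] coding_stake[OF 1(2), of n] 1(3) by simp
    have "\<delta> \<le> \<bar>\<pi> (sdrop n x) - \<pi> (sdrop n y)\<bar>" using \<delta>(2)[OF xn] 1(3) by simp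
    moreover have "0 \<le> weight (\<lambda>i. \<bar>a i\<bar>) (stake n x)" by (rule weight_nonneg[OF _ w]) simp
    ultimately show ?case unfolding eq by (intro mult_left_mono)
  next
    case (2 x y n)
    then have xn: "sdrop n x \<in> streams I" "sdrop n y \<in> streams I" using sdrop_in_streams by blast+
    have w: "stake n x \<in> lists I" by (rule stake_in_lists[OF 2(1)])
    have eq: "\<bar>\<pi> x - \<pi> y\<bar> = weight (\<lambda>i. \<bar>a i\<bar>) (stake n x) * \<bar>\<pi> (sdrop n x) - \<pi> (sdrop n y)\<bar>"
      using word_difference[OF w coding_in_X[OF xn(1)] coding_in_X[OF xn(2)]]
        coding_stake[OF 2(1), of n] coding_stake[OF 2(2), of n] 2(3) by simp
    have "\<bar>\<pi> (sdrop n x) - \<pi> (sdrop n y)\<bar> \<le> 2 * \<bar>K\<bar> + 1"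
      using K[OF coding_in_X[OF xn(1)]] K[OF coding_in_X[OF xn(2)]] by linarith
    moreover have "0 \<le> weight (\<lambda>i. \<bar>a i\<bar>) (stake n x)" by (rule weight_nonneg[OF _ w]) simp
    ultimately show ?case unfolding eq by (intro mult_left_mono)
  qed
qed

end

section \<open>Bi-Lipschitz conjugacy\<close>

text \<open>
  A two-sided Lipschitz estimate for \<open>h\<close> contains injectivity and the Lipschitz property of the inverse, so that
  \<open>inv_into\<close> does not occur any more.  This form is easily inverted and composed.
\<close>

lemma cs_equiv_iff:
  "(\<Phi>, \<Psi>) \<in> cs_equiv d \<longleftrightarrow> \<Phi> \<in> CS d \<and> \<Psi> \<in> CS d \<and>
    (\<exists>h L. L > 0 \<and> h ` limit_set d \<Phi> = limit_set d \<Psi> \<and>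
      (\<forall>x\<in>limit_set d \<Phi>. \<forall>y\<in>limit_set d \<Phi>. \<bar>h x - h y\<bar> \<le> L * \<bar>x - y\<bar> \<and> \<bar>x - y\<bar> \<le> L * \<bar>h x - h y\<bar>) \<and>
      (\<forall>i\<in>{1..d}. \<forall>x\<in>limit_set d \<Phi>. gen \<Psi> i (h x) = h (gen \<Phi> i x)))"
  (is "_ \<longleftrightarrow> _ \<and> _ \<and> (\<exists>h L. ?P h L)")
proof -
  define A where "A = limit_set d \<Phi>"
  define B where "B = limit_set d \<Psi>"
  have "(\<exists>h. bij_betw h A B \<and> (\<exists>L. L-lipschitz_on A h) \<and> (\<exists>L. L-lipschitz_on B (inv_into A h)) \<and>
      (\<forall>i\<in>{1..d}. \<forall>y\<in>B. gen \<Psi> i y = h (gen \<Phi> i (inv_into A h y)))) \<longleftrightarrow> (\<exists>h L. ?P h L)" (is "?l \<longleftrightarrow> ?r")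
  proof
    assume ?l
    then obtain h L L' where h: "bij_betw h A B" and L: "L-lipschitz_on A h" and L': "L'-lipschitz_on B (inv_into A h)"
      and conj: "\<forall>i\<in>{1..d}. \<forall>y\<in>B. gen \<Psi> i y = h (gen \<Phi> i (inv_into A h y))" by blast
    have hB: "h x \<in> B" and inv: "inv_into A h (h x) = x" if "x \<in> A" for x
      using h that by (auto simp: bij_betw_def inv_into_f_f)
    define K where "K = \<bar>L\<bar> + \<bar>L'\<bar> + 1"
    have "\<bar>h x - h y\<bar> \<le> K * \<bar>x - y\<bar> \<and> \<bar>x - y\<bar> \<le> K * \<bar>h x - h y\<bar>" if x: "x \<in> A" and y: "y \<in> A" for x y
    proof -
      have "\<bar>h x - h y\<bar> \<le> L * \<bar>x - y\<bar>" using lipschitz_onD[OF L x y] by (simp add: dist_real_def)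
      also have "\<dots> \<le> K * \<bar>x - y\<bar>" by (intro mult_right_mono) (auto simp: K_def)
      finally have 1: "\<bar>h x - h y\<bar> \<le> K * \<bar>x - y\<bar>" .
      have "\<bar>x - y\<bar> \<le> L' * \<bar>h x - h y\<bar>"
        using lipschitz_onD[OF L' hB[OF x] hB[OF y]] by (simp add: dist_real_def inv[OF x] inv[OF y])
      also have "\<dots> \<le> K * \<bar>h x - h y\<bar>" by (intro mult_right_mono) (auto simp: K_def)
      finally show ?thesis using 1 by simp
    qed
    moreover have "K > 0" by (simp add: K_def)
    moreover have "h ` A = B" using h by (simp add: bij_betw_def)
    moreover have "\<forall>i\<in>{1..d}. \<forall>x\<in>A. gen \<Psi> i (h x) = h (gen \<Phi> i x)" using conj hB inv by simp
    ultimately show ?r unfolding A_def B_def by blast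
  next
    assume ?r
    then obtain h L where L: "L > 0" and img: "h ` A = B"
      and bi: "\<And>x y. x \<in> A \<Longrightarrow> y \<in> A \<Longrightarrow> \<bar>h x - h y\<bar> \<le> L * \<bar>x - y\<bar> \<and> \<bar>x - y\<bar> \<le> L * \<bar>h x - h y\<bar>"
      and conj: "\<And>i x. i \<in> {1..d} \<Longrightarrow> x \<in> A \<Longrightarrow> gen \<Psi> i (h x) = h (gen \<Phi> i x)"
      unfolding A_def B_def by blast
    have inj: "inj_on h A" using bi by (fastforce intro: inj_onI)
    then have bij: "bij_betw h A B" using img by (simp add: bij_betw_def)
    have inv: "inv_into A h y \<in> A" "h (inv_into A h y) = y" if "y \<in> B" for y
      using that img inv_into_into[of y h A] f_inv_into_f[of y h A] by auto
    have "L-lipschitz_on A h" using L bi by (intro lipschitz_onI) (auto simp: dist_real_def)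
    moreover have "L-lipschitz_on B (inv_into A h)"
    proof (rule lipschitz_onI)
      fix x y assume "x \<in> B" "y \<in> B"
      then show "dist (inv_into A h x) (inv_into A h y) \<le> L * dist x y"
        using bi[of "inv_into A h x" "inv_into A h y"] inv by (simp add: dist_real_def)
    qed (use L in simp)
    moreover have "\<forall>i\<in>{1..d}. \<forall>y\<in>B. gen \<Psi> i y = h (gen \<Phi> i (inv_into A h y))"
      using conj inv by metis
    ultimately show ?l using bij by blast
  qed
  then show ?thesis unfolding cs_equiv_def A_def B_def by simp
qed

lemma cs_equivI:
  assumes "\<Phi> \<in> CS d" "\<Psi> \<in> CS d" "L > 0" "h ` limit_set d \<Phi> = limit_set d \<Psi>"
    and "\<And>x y. x \<in> limit_set d \<Phi> \<Longrightarrow> y \<in> limit_set d \<Phi> \<Longrightarrow>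
      \<bar>h x - h y\<bar> \<le> L * \<bar>x - y\<bar> \<and> \<bar>x - y\<bar> \<le> L * \<bar>h x - h y\<bar>"
    and "\<And>i x. i \<in> {1..d} \<Longrightarrow> x \<in> limit_set d \<Phi> \<Longrightarrow> gen \<Psi> i (h x) = h (gen \<Phi> i x)"
  shows "(\<Phi>, \<Psi>) \<in> cs_equiv d"
  unfolding cs_equiv_iff using assms by (intro conjI exI[of _ h] exI[of _ L] ballI) simp_all

lemma cs_equivE:
  assumes "(\<Phi>, \<Psi>) \<in> cs_equiv d"
  obtains h L where "\<Phi> \<in> CS d" "\<Psi> \<in> CS d" "L > 0" "h ` limit_set d \<Phi> = limit_set d \<Psi>"
    and "\<And>x y. x \<in> limit_set d \<Phi> \<Longrightarrow> y \<in> limit_set d \<Phi> \<Longrightarrow>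
      \<bar>h x - h y\<bar> \<le> L * \<bar>x - y\<bar> \<and> \<bar>x - y\<bar> \<le> L * \<bar>h x - h y\<bar>"
    and "\<And>i x. i \<in> {1..d} \<Longrightarrow> x \<in> limit_set d \<Phi> \<Longrightarrow> gen \<Psi> i (h x) = h (gen \<Phi> i x)"
proof -
  from assms[unfolded cs_equiv_iff] obtain h L where "\<Phi> \<in> CS d" "\<Psi> \<in> CS d" "L > 0"
      "h ` limit_set d \<Phi> = limit_set d \<Psi>"
      "\<forall>x\<in>limit_set d \<Phi>. \<forall>y\<in>limit_set d \<Phi>. \<bar>h x - h y\<bar> \<le> L * \<bar>x - y\<bar> \<and> \<bar>x - y\<bar> \<le> L * \<bar>h x - h y\<bar>"
      "\<forall>i\<in>{1..d}. \<forall>x\<in>limit_set d \<Phi>. gen \<Psi> i (h x) = h (gen \<Phi> i x)"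
    by (elim conjE exE) (rule that)
  then show ?thesis by (intro that[of L h]) simp_all
qed

lemma cs_equiv_refl: "\<Phi> \<in> CS d \<Longrightarrow> (\<Phi>, \<Phi>) \<in> cs_equiv d"
  by (rule cs_equivI[where h = "\<lambda>x. x" and L = 1]) simp_all

lemma cs_equiv_sym:
  assumes "(\<Phi>, \<Psi>) \<in> cs_equiv d"
  shows "(\<Psi>, \<Phi>) \<in> cs_equiv d"
proof -
  obtain h L where CS: "\<Phi> \<in> CS d" "\<Psi> \<in> CS d" and L: "L > 0" and img: "h ` limit_set d \<Phi> = limit_set d \<Psi>"
    and bi: "\<And>x y. x \<in> limit_set d \<Phi> \<Longrightarrow> y \<in> limit_set d \<Phi> \<Longrightarrow>
      \<bar>h x - h y\<bar> \<le> L * \<bar>x - y\<bar> \<and> \<bar>x - y\<bar> \<le> L * \<bar>h x - h y\<bar>"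
    and conj: "\<And>i x. i \<in> {1..d} \<Longrightarrow> x \<in> limit_set d \<Phi> \<Longrightarrow> gen \<Psi> i (h x) = h (gen \<Phi> i x)"
    using assms by (rule cs_equivE) (rule that; assumption)
  interpret conformal_system d \<Phi> by unfold_locales (rule CS)
  have inj: "inj_on h \<Lambda>"
  proof (rule inj_onI)
    fix x y assume "x \<in> \<Lambda>" "y \<in> \<Lambda>" "h x = h y"
    then show "x = y" using bi[of x y] by simp
  qed
  define g where "g = inv_into \<Lambda> h"
  have gh: "g (h x) = x" if "x \<in> \<Lambda>" for x unfolding g_def by (rule inv_into_f_f[OF inj that])
  show ?thesis
  proof (rule cs_equivI[OF CS(2,1) L, where h = g])
    show "g ` limit_set d \<Psi> = \<Lambda>" unfolding img[symmetric] image_image using gh by simp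
    fix x y assume "x \<in> limit_set d \<Psi>" "y \<in> limit_set d \<Psi>"
    then obtain x' y' where "x' \<in> \<Lambda>" "y' \<in> \<Lambda>" "x = h x'" "y = h y'" unfolding img[symmetric] by blast
    then show "\<bar>g x - g y\<bar> \<le> L * \<bar>x - y\<bar> \<and> \<bar>x - y\<bar> \<le> L * \<bar>g x - g y\<bar>" using bi gh by simp
  next
    fix i x assume i: "i \<in> I" and "x \<in> limit_set d \<Psi>"
    then obtain x' where x': "x' \<in> \<Lambda>" "x = h x'" unfolding img[symmetric] by blast
    then show "\<phi> i (g x) = g (gen \<Psi> i x)" using conj[OF i x'(1)] gh gen_limit_set[OF i x'(1)] by simp
  qed
qed

lemma cs_equiv_trans:
  assumes "(\<Phi>, \<Psi>) \<in> cs_equiv d" "(\<Psi>, \<Omega>) \<in> cs_equiv d"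
  shows "(\<Phi>, \<Omega>) \<in> cs_equiv d"
proof -
  obtain h L where CS: "\<Phi> \<in> CS d" and L: "L > 0" and img: "h ` limit_set d \<Phi> = limit_set d \<Psi>"
    and bi: "\<And>x y. x \<in> limit_set d \<Phi> \<Longrightarrow> y \<in> limit_set d \<Phi> \<Longrightarrow>
      \<bar>h x - h y\<bar> \<le> L * \<bar>x - y\<bar> \<and> \<bar>x - y\<bar> \<le> L * \<bar>h x - h y\<bar>"
    and conj: "\<And>i x. i \<in> {1..d} \<Longrightarrow> x \<in> limit_set d \<Phi> \<Longrightarrow> gen \<Psi> i (h x) = h (gen \<Phi> i x)"
    using assms(1) by (rule cs_equivE) (rule that; assumption)
  obtain h' L' where CS': "\<Omega> \<in> CS d" and L': "L' > 0" and img': "h' ` limit_set d \<Psi> = limit_set d \<Omega>"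
    and bi': "\<And>x y. x \<in> limit_set d \<Psi> \<Longrightarrow> y \<in> limit_set d \<Psi> \<Longrightarrow>
      \<bar>h' x - h' y\<bar> \<le> L' * \<bar>x - y\<bar> \<and> \<bar>x - y\<bar> \<le> L' * \<bar>h' x - h' y\<bar>"
    and conj': "\<And>i x. i \<in> {1..d} \<Longrightarrow> x \<in> limit_set d \<Psi> \<Longrightarrow> gen \<Omega> i (h' x) = h' (gen \<Psi> i x)"
    using assms(2) by (rule cs_equivE) (rule that; assumption)
  have hx: "h x \<in> limit_set d \<Psi>" if "x \<in> limit_set d \<Phi>" for x using img that by blast
  show ?thesis
  proof (rule cs_equivI[OF CS CS', where h = "\<lambda>x. h' (h x)" and L = "L' * L"])
    show "0 < L' * L" using L L' by simp
    show "(\<lambda>x. h' (h x)) ` limit_set d \<Phi> = limit_set d \<Omega>"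
      unfolding img'[symmetric] img[symmetric] image_image ..
    fix x y assume xy: "x \<in> limit_set d \<Phi>" "y \<in> limit_set d \<Phi>"
    have "\<bar>h' (h x) - h' (h y)\<bar> \<le> L' * \<bar>h x - h y\<bar>" using bi'[OF hx hx] xy by blast
    also have "\<dots> \<le> L' * (L * \<bar>x - y\<bar>)" using bi[OF xy] L' by (intro mult_left_mono) auto
    finally have 1: "\<bar>h' (h x) - h' (h y)\<bar> \<le> L' * L * \<bar>x - y\<bar>" by (simp add: mult.assoc)
    have "\<bar>x - y\<bar> \<le> L * \<bar>h x - h y\<bar>" using bi[OF xy] by blast
    also have "\<dots> \<le> L * (L' * \<bar>h' (h x) - h' (h y)\<bar>)"
      using bi'[OF hx hx] xy L by (intro mult_left_mono) auto
    finally show "\<bar>h' (h x) - h' (h y)\<bar> \<le> L' * L * \<bar>x - y\<bar> \<and> \<bar>x - y\<bar> \<le> L' * L * \<bar>h' (h x) - h' (h y)\<bar>"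
      using 1 by (simp add: mult.assoc mult.left_commute)
  next
    fix i x assume "i \<in> {1..d}" "x \<in> limit_set d \<Phi>"
    then show "gen \<Omega> i (h' (h x)) = h' (h (gen \<Phi> i x))" using conj conj' hx by simp
  qed
qed

text \<open>
  The conjugacy carries \<open>\<bar>\<phi>\<^sub>\<omega> \<xi> - \<phi>\<^sub>\<omega> \<eta>\<bar>\<close> to the corresponding distance in the affine system with a bounded factor,
  and that distance is the product of the \<open>\<bar>a\<^sub>i\<bar>\<close> along \<open>\<omega>\<close> times a constant.
\<close>

lemma has_ratios_of_equiv_affine:
  assumes d: "d \<ge> 2" and equiv: "(\<Phi>, \<Psi>) \<in> cs_equiv d" and slopes: "has_slopes d \<Psi> a"
  shows "has_ratios d \<Phi> (\<lambda>i. \<bar>a i\<bar>)"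
proof -
  obtain h L where CS: "\<Phi> \<in> CS d" "\<Psi> \<in> CS d" and L: "L > 0" and img: "h ` limit_set d \<Phi> = limit_set d \<Psi>"
    and bi: "\<And>x y. x \<in> limit_set d \<Phi> \<Longrightarrow> y \<in> limit_set d \<Phi> \<Longrightarrow>
      \<bar>h x - h y\<bar> \<le> L * \<bar>x - y\<bar> \<and> \<bar>x - y\<bar> \<le> L * \<bar>h x - h y\<bar>"
    and conj: "\<And>i x. i \<in> {1..d} \<Longrightarrow> x \<in> limit_set d \<Phi> \<Longrightarrow> gen \<Psi> i (h x) = h (gen \<Phi> i x)"
    using equiv by (rule cs_equivE) (rule that; assumption)
  interpret P: conformal_system d \<Phi> by unfold_locales (rule CS)
  interpret Q: affine_system d \<Psi> a by unfold_locales (rule CS slopes)+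
  obtain \<xi> \<eta> where \<xi>: "\<xi> \<in> P.\<Lambda>" and \<eta>: "\<eta> \<in> P.\<Lambda>" and neq: "\<xi> \<noteq> \<eta>" by (rule P.limit_set_two_points[OF d])
  obtain D where D: "\<forall>\<omega>\<in>lists {1..d}. \<forall>x\<in>sstart {1..d} \<omega>.
      \<bar>birkhoff_sum (geometric_potential \<Phi>) (length \<omega>) x - ln \<bar>P.\<phi>w \<omega> \<xi> - P.\<phi>w \<omega> \<eta>\<bar>\<bar> \<le> D"
    using P.birkhoff_sum_comparable[OF \<xi> \<eta> neq] by blast
  have conj_word: "Q.\<phi>w \<omega> (h x) = h (P.\<phi>w \<omega> x)" if "\<omega> \<in> lists {1..d}" "x \<in> P.\<Lambda>" for \<omega> x
    using that
  proof (induction rule: lists.induct)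
    case (Cons i \<omega>)
    then show ?case using conj[OF Cons.hyps(1) P.word_limit_set[OF Cons.hyps(2) Cons.prems]] by simp
  qed simp
  have hX: "h x \<in> Q.X" if "x \<in> P.\<Lambda>" for x
    using that img Q.limit_set_interior Q.interior_in_X by blast
  have hneq: "0 < \<bar>h \<xi> - h \<eta>\<bar>" using bi[OF \<xi> \<eta>] neq by (cases "h \<xi> = h \<eta>") simp_all
  have pos: "0 < \<bar>a i\<bar>" if "i \<in> {1..d}" for i using Q.slope_nonzero[OF that] by simp
  have "\<bar>birkhoff_sum (geometric_potential \<Phi>) (length \<omega>) x - ln (weight (\<lambda>i. \<bar>a i\<bar>) \<omega>)\<bar>
      \<le> D + \<bar>ln L\<bar> + \<bar>ln \<bar>h \<xi> - h \<eta>\<bar>\<bar>" if w: "\<omega> \<in> lists {1..d}" and x: "x \<in> sstart {1..d} \<omega>" for \<omega> x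
  proof -
    define W where "W = weight (\<lambda>i. \<bar>a i\<bar>) \<omega>"
    define A where "A = \<bar>P.\<phi>w \<omega> \<xi> - P.\<phi>w \<omega> \<eta>\<bar>"
    have W: "0 < W" unfolding W_def by (rule weight_pos[OF pos w])
    have "\<bar>h (P.\<phi>w \<omega> \<xi>) - h (P.\<phi>w \<omega> \<eta>)\<bar> = W * \<bar>h \<xi> - h \<eta>\<bar>"
      unfolding conj_word[OF w \<xi>, symmetric] conj_word[OF w \<eta>, symmetric] W_def
      by (rule Q.word_difference[OF w hX[OF \<xi>] hX[OF \<eta>]])
    then have le: "W * \<bar>h \<xi> - h \<eta>\<bar> \<le> L * A" "A \<le> L * (W * \<bar>h \<xi> - h \<eta>\<bar>)"
      using bi[OF P.word_limit_set[OF w \<xi>] P.word_limit_set[OF w \<eta>]] by (simp_all add: A_def)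
    have Wh: "0 < W * \<bar>h \<xi> - h \<eta>\<bar>" using W hneq by simp
    then have "0 < L * A" using le(1) by linarith
    then have A: "0 < A" using L by (simp add: zero_less_mult_iff)
    have "ln (W * \<bar>h \<xi> - h \<eta>\<bar>) \<le> ln (L * A)" "ln A \<le> ln (L * (W * \<bar>h \<xi> - h \<eta>\<bar>))"
      using le A L Wh by simp_all
    then have "ln W + ln \<bar>h \<xi> - h \<eta>\<bar> \<le> ln L + ln A" "ln A \<le> ln L + (ln W + ln \<bar>h \<xi> - h \<eta>\<bar>)"
      using L A W hneq by (simp_all add: ln_mult)
    moreover have "\<bar>birkhoff_sum (geometric_potential \<Phi>) (length \<omega>) x - ln A\<bar> \<le> D"
      unfolding A_def using D w x by blast
    ultimately show ?thesis unfolding W_def[symmetric] by linarith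
  qed
  then show ?thesis unfolding has_ratios_def using pos by blast
qed

lemma stream_first_difference:
  assumes "x \<noteq> y"
  obtains n where "stake n x = stake n y" "x !! n \<noteq> y !! n"
proof -
  have "\<exists>n. x !! n \<noteq> y !! n"
  proof (rule ccontr)
    assume "\<not> ?thesis"
    then have "x = y"
    proof (coinduction arbitrary: x y)
      case Eq_stream
      then show ?case by (metis snth.simps)
    qed
    then show False using assms by simp
  qed
  then obtain n where n: "x !! n \<noteq> y !! n" "\<And>m. m < n \<Longrightarrow> x !! m = y !! m"
    using exists_least_iff[of "\<lambda>n. x !! n \<noteq> y !! n"] by blast
  have "stake n x = stake n y" by (rule nth_equalityI) (simp_all add: n(2))
  then show ?thesis using that n(1) by blast
qed

text \<open>
  Both distances are comparable with the weight of the common prefix of the two codes.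
\<close>

lemma coding_comparison:
  assumes \<Phi>: "affine_system d \<Phi> a" and \<Psi>: "affine_system d \<Psi> b"
    and eq: "\<And>i. i \<in> {1..d} \<Longrightarrow> \<bar>a i\<bar> = \<bar>b i\<bar>"
  shows "\<exists>L>0. \<forall>x\<in>streams {1..d}. \<forall>y\<in>streams {1..d}.
    \<bar>coding_map \<Psi> x - coding_map \<Psi> y\<bar> \<le> L * \<bar>coding_map \<Phi> x - coding_map \<Phi> y\<bar>"
proof -
  interpret P: affine_system d \<Phi> a by fact
  interpret Q: affine_system d \<Psi> b by fact
  obtain \<delta> where \<delta>: "\<delta> > 0" "\<And>x y n. x \<in> streams {1..d} \<Longrightarrow> y \<in> streams {1..d} \<Longrightarrow>
      stake n x = stake n y \<and> x !! n \<noteq> y !! n \<Longrightarrow>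
      weight (\<lambda>i. \<bar>a i\<bar>) (stake n x) * \<delta> \<le> \<bar>coding_map \<Phi> x - coding_map \<Phi> y\<bar>"
    using P.coding_difference by blast
  obtain M where M: "M > 0" "\<And>x y n. x \<in> streams {1..d} \<Longrightarrow> y \<in> streams {1..d} \<Longrightarrow>
      stake n x = stake n y \<and> x !! n \<noteq> y !! n \<Longrightarrow>
      \<bar>coding_map \<Psi> x - coding_map \<Psi> y\<bar> \<le> weight (\<lambda>i. \<bar>b i\<bar>) (stake n x) * M"
    using Q.coding_difference by blast
  have "\<bar>coding_map \<Psi> x - coding_map \<Psi> y\<bar> \<le> M / \<delta> * \<bar>coding_map \<Phi> x - coding_map \<Phi> y\<bar>"
    if x: "x \<in> streams {1..d}" and y: "y \<in> streams {1..d}" for x y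
  proof (cases "x = y")
    case False
    then obtain n where n: "stake n x = stake n y" "x !! n \<noteq> y !! n" by (rule stream_first_difference)
    have "set (stake n x) \<subseteq> {1..d}" using stake_in_lists[OF x, of n] by auto
    then have w: "weight (\<lambda>i. \<bar>b i\<bar>) (stake n x) = weight (\<lambda>i. \<bar>a i\<bar>) (stake n x)"
      using eq by (intro arg_cong[of _ _ prod_list] map_cong) auto
    have "\<bar>coding_map \<Psi> x - coding_map \<Psi> y\<bar> \<le> weight (\<lambda>i. \<bar>a i\<bar>) (stake n x) * M"
      using M(2)[OF x y conjI[OF n]] unfolding w .
    also have "\<dots> = M / \<delta> * (weight (\<lambda>i. \<bar>a i\<bar>) (stake n x) * \<delta>)" using \<delta>(1) by simp
    also have "\<dots> \<le> M / \<delta> * \<bar>coding_map \<Phi> x - coding_map \<Phi> y\<bar>"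
      using \<delta>(1) M(1) \<delta>(2)[OF x y conjI[OF n]] by (intro mult_left_mono) auto
    finally show ?thesis .
  qed simp
  then show ?thesis using \<delta>(1) M(1) by (intro exI[of _ "M / \<delta>"]) simp
qed

text \<open>
  The conjugacy sends the point with a given code to the point with the same code.  The comparison of
  increments in both directions makes it well defined and bi-Lipschitz.  Only the absolute values of the
  slopes enter: orientation and order of the image intervals are irrelevant.
\<close>

lemma affine_equal_ratios_equiv:
  assumes \<Phi>: "affine_system d \<Phi> a" and \<Psi>: "affine_system d \<Psi> b"
    and eq: "\<And>i. i \<in> {1..d} \<Longrightarrow> \<bar>a i\<bar> = \<bar>b i\<bar>"
  shows "(\<Phi>, \<Psi>) \<in> cs_equiv d"
proof -
  interpret P: affine_system d \<Phi> a by fact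
  interpret Q: affine_system d \<Psi> b by fact
  obtain L where L: "L > 0" "\<And>x y. x \<in> streams {1..d} \<Longrightarrow> y \<in> streams {1..d} \<Longrightarrow> \<bar>Q.\<pi> x - Q.\<pi> y\<bar> \<le> L * \<bar>P.\<pi> x - P.\<pi> y\<bar>"
    using coding_comparison[OF \<Phi> \<Psi> eq] by blast
  obtain M where M: "M > 0" "\<And>x y. x \<in> streams {1..d} \<Longrightarrow> y \<in> streams {1..d} \<Longrightarrow> \<bar>P.\<pi> x - P.\<pi> y\<bar> \<le> M * \<bar>Q.\<pi> x - Q.\<pi> y\<bar>"
    using coding_comparison[OF \<Psi> \<Phi> eq[symmetric]] by blast
  define h where "h = (\<lambda>y. Q.\<pi> (inv_into (streams {1..d}) P.\<pi> y))"
  have inj: "inj_on P.\<pi> (streams {1..d})"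
  proof (rule inj_onI, rule ccontr)
    fix x y assume x: "x \<in> streams {1..d}" and y: "y \<in> streams {1..d}" and e: "P.\<pi> x = P.\<pi> y" and "x \<noteq> y"
    from \<open>x \<noteq> y\<close> obtain n where n: "stake n x = stake n y" "x !! n \<noteq> y !! n" by (rule stream_first_difference)
    obtain \<delta> where "\<delta> > 0" "weight (\<lambda>i. \<bar>a i\<bar>) (stake n x) * \<delta> \<le> \<bar>P.\<pi> x - P.\<pi> y\<bar>"
      using P.coding_difference x y n by blast
    moreover have "0 < weight (\<lambda>i. \<bar>a i\<bar>) (stake n x)"
      by (rule weight_pos[OF _ stake_in_lists[OF x]]) (simp add: P.slope_nonzero)
    ultimately show False using e by (simp add: mult_le_0_iff)
  qed
  have h: "h (P.\<pi> x) = Q.\<pi> x" if "x \<in> streams {1..d}" for x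
    unfolding h_def by (simp only: inv_into_f_f[OF inj that])
  show ?thesis
  proof (rule cs_equivI[OF P.in_CS Q.in_CS, where h = h and L = "L + M"])
    show "0 < L + M" using L M by simp
    show "h ` P.\<Lambda> = Q.\<Lambda>"
      unfolding P.limit_set_eq_coding Q.limit_set_eq_coding image_image using h by (intro image_cong) simp_all
    fix s t assume "s \<in> P.\<Lambda>" "t \<in> P.\<Lambda>"
    then obtain x y where x: "x \<in> streams {1..d}" "s = P.\<pi> x" and y: "y \<in> streams {1..d}" "t = P.\<pi> y"
      unfolding P.limit_set_eq_coding by blast
    have "\<bar>Q.\<pi> x - Q.\<pi> y\<bar> \<le> L * \<bar>P.\<pi> x - P.\<pi> y\<bar>" "\<bar>P.\<pi> x - P.\<pi> y\<bar> \<le> M * \<bar>Q.\<pi> x - Q.\<pi> y\<bar>"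
      using L(2) M(2) x y by blast+
    moreover have "0 \<le> M * \<bar>P.\<pi> x - P.\<pi> y\<bar>" "0 \<le> L * \<bar>Q.\<pi> x - Q.\<pi> y\<bar>" using L(1) M(1) by simp_all
    ultimately show "\<bar>h s - h t\<bar> \<le> (L + M) * \<bar>s - t\<bar> \<and> \<bar>s - t\<bar> \<le> (L + M) * \<bar>h s - h t\<bar>"
      unfolding x(2) y(2) h[OF x(1)] h[OF y(1)] distrib_right by linarith
  next
    fix i s assume i: "i \<in> {1..d}" and "s \<in> P.\<Lambda>"
    then obtain x where x: "x \<in> streams {1..d}" "s = P.\<pi> x" unfolding P.limit_set_eq_coding by blast
    have ix: "i ## x \<in> streams {1..d}" unfolding streams_Stream using i x(1) by (rule conjI)
    show "gen \<Psi> i (h s) = h (gen \<Phi> i s)"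
      using h[OF ix] unfolding P.coding_Stream[OF i x(1)] Q.coding_Stream[OF i x(1)] x(2) h[OF x(1)] by simp
  qed
qed

section \<open>Permuting the generators\<close>

lemma gen_permute [simp]: "gen (permute_gens \<tau> \<Psi>) = (\<lambda>i. gen \<Psi> (\<tau> i))"
  and dom_permute [simp]: "dom (permute_gens \<tau> \<Psi>) = dom \<Psi>"
  by (simp_all add: permute_gens_def)

lemma foldr_permute: "foldr (\<lambda>i. f (\<tau> i)) \<omega> = foldr f (map \<tau> \<omega>)"
  by (induction \<omega>) simp_all

context
  fixes \<tau> :: "nat \<Rightarrow> nat" and d :: nat
  assumes \<tau>: "\<tau> permutes {1..d}"
begin

lemma permuted_index: "i \<in> {1..d} \<Longrightarrow> \<tau> i \<in> {1..d}"
  using permutes_in_image[OF \<tau>] by blast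

lemma permuted_word: "\<omega> \<in> lists {1..d} \<Longrightarrow> map \<tau> \<omega> \<in> lists {1..d}"
proof (induction rule: lists.induct)
  case (Cons i \<omega>)
  show ?case unfolding list.map by (rule lists.Cons[OF permuted_index[OF Cons.hyps(1)] Cons.IH])
qed simp

lemma map_words: "map \<tau> ` words d n = words d n"
proof
  show "map \<tau> ` words d n \<subseteq> words d n"
    using permuted_word by (auto simp: words_def simp del: in_lists_conv_set)
  show "words d n \<subseteq> map \<tau> ` words d n"
  proof
    fix \<omega> assume w: "\<omega> \<in> words d n"
    have "\<omega> = map \<tau> (map (inv \<tau>) \<omega>)"
      by (simp add: o_def permutes_inverses(1)[OF \<tau>])
    moreover have "set (map (inv \<tau>) \<omega>) \<subseteq> {1..d}"
      using w permutes_in_image[OF permutes_inv[OF \<tau>]] by (auto simp: words_def simp del: atLeastAtMost_iff)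
    then have "map (inv \<tau>) \<omega> \<in> words d n"
      using w by (auto simp: words_def)
    ultimately show "\<omega> \<in> map \<tau> ` words d n" by (rule image_eqI)
  qed
qed

lemma limit_set_permute: "limit_set d (permute_gens \<tau> \<Psi>) = limit_set d \<Psi>"
proof -
  have "(\<Union>\<omega>\<in>words d n. foldr (gen \<Psi>) (map \<tau> \<omega>) ` dom \<Psi>) = (\<Union>\<omega>\<in>words d n. foldr (gen \<Psi>) \<omega> ` dom \<Psi>)" for n
    by (subst (2) map_words[of n, symmetric]) simp
  then show ?thesis unfolding limit_set_def gen_permute dom_permute foldr_permute by simp
qed

lemma permute_in_CS:
  assumes "\<Psi> \<in> CS d"
  shows "permute_gens \<tau> \<Psi> \<in> CS d"
proof -
  have neq: "\<tau> i \<noteq> \<tau> j" if "i \<noteq> j" for i j using injD[OF permutes_inj[OF \<tau>]] that by blast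
  obtain U F where UF: "open U \<and> connected U \<and> complex_of_real ` dom \<Psi> \<subseteq> U \<and>
        (\<forall>i\<in>{1..d}. F i holomorphic_on U \<and> (\<forall>z\<in>U. deriv (F i) z \<noteq> 0) \<and> F i ` U \<subseteq> U \<and>
           (\<forall>x\<in>dom \<Psi>. F i (complex_of_real x) = complex_of_real (gen \<Psi> i x))) \<and>
        (\<exists>C\<ge>1. \<forall>\<omega>\<in>lists {1..d}. \<forall>x\<in>U. \<forall>y\<in>U.
           cmod (deriv (foldr F \<omega>) y) \<le> C * cmod (deriv (foldr F \<omega>) x))"
  proof -
    have "conformal_bounded_distortion d \<Psi>" using assms by (simp add: CS_def)
    then show thesis unfolding conformal_bounded_distortion_def by (elim exE) (rule that)
  qed
  have "conformal_bounded_distortion d (permute_gens \<tau> \<Psi>)"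
    unfolding conformal_bounded_distortion_def gen_permute dom_permute
  proof (intro exI[of _ U] exI[of _ "\<lambda>i. F (\<tau> i)"] conjI)
    show "open U" "connected U" "complex_of_real ` dom \<Psi> \<subseteq> U" using UF by - (elim conjE, assumption)+
    have "\<forall>i\<in>{1..d}. F i holomorphic_on U \<and> (\<forall>z\<in>U. deriv (F i) z \<noteq> 0) \<and> F i ` U \<subseteq> U \<and>
           (\<forall>x\<in>dom \<Psi>. F i (complex_of_real x) = complex_of_real (gen \<Psi> i x))" using UF by (elim conjE) assumption
    then show "\<forall>i\<in>{1..d}. F (\<tau> i) holomorphic_on U \<and> (\<forall>z\<in>U. deriv (F (\<tau> i)) z \<noteq> 0) \<and> F (\<tau> i) ` U \<subseteq> U \<and>
           (\<forall>x\<in>dom \<Psi>. F (\<tau> i) (complex_of_real x) = complex_of_real (gen \<Psi> (\<tau> i) x))"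
      by (intro ballI) (drule bspec[OF _ permuted_index]; assumption)
    have "\<exists>C\<ge>1. \<forall>\<omega>\<in>lists {1..d}. \<forall>x\<in>U. \<forall>y\<in>U. cmod (deriv (foldr F \<omega>) y) \<le> C * cmod (deriv (foldr F \<omega>) x)"
      using UF by (elim conjE) assumption
    then show "\<exists>C\<ge>1. \<forall>\<omega>\<in>lists {1..d}. \<forall>x\<in>U. \<forall>y\<in>U.
        cmod (deriv (foldr (\<lambda>i. F (\<tau> i)) \<omega>) y) \<le> C * cmod (deriv (foldr (\<lambda>i. F (\<tau> i)) \<omega>) x)"
      unfolding foldr_permute using permuted_word by blast
  qed
  moreover have "gen \<Psi> (\<tau> i) ` interior (dom \<Psi>) \<inter> gen \<Psi> (\<tau> j) ` interior (dom \<Psi>) = {}"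
    if "i \<in> {1..d}" "j \<in> {1..d}" "i \<noteq> j" for i j
  proof -
    have "\<forall>i\<in>{1..d}. \<forall>j\<in>{1..d}. i \<noteq> j \<longrightarrow> gen \<Psi> i ` interior (dom \<Psi>) \<inter> gen \<Psi> j ` interior (dom \<Psi>) = {}"
      using assms unfolding CS_def by blast
    then show ?thesis using permuted_index that neq[OF that(3)] by blast
  qed
  moreover have "gen \<Psi> (\<tau> i) ` dom \<Psi> \<subseteq> interior (dom \<Psi>) \<and> inj_on (gen \<Psi> (\<tau> i)) (dom \<Psi>) \<and>
        (\<exists>c<1. c-lipschitz_on (dom \<Psi>) (gen \<Psi> (\<tau> i)))" if "i \<in> {1..d}" for i
  proof -
    have "\<forall>i\<in>{1..d}. gen \<Psi> i ` dom \<Psi> \<subseteq> interior (dom \<Psi>) \<and> inj_on (gen \<Psi> i) (dom \<Psi>) \<and>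
        (\<exists>c<1. c-lipschitz_on (dom \<Psi>) (gen \<Psi> i))" using assms unfolding CS_def by blast
    then show ?thesis using permuted_index[OF that] by blast
  qed
  moreover have "gen \<Psi> (\<tau> i) ` interior (dom \<Psi>) \<subseteq> interior (dom \<Psi>)" if "i \<in> {1..d}" for i
  proof -
    have "\<forall>i\<in>{1..d}. gen \<Psi> i ` interior (dom \<Psi>) \<subseteq> interior (dom \<Psi>)" using assms unfolding CS_def by blast
    then show ?thesis using permuted_index[OF that] by blast
  qed
  moreover have "dom \<Psi> \<noteq> {}" "connected (dom \<Psi>)" "compact (dom \<Psi>)" using assms unfolding CS_def by blast+
  ultimately show ?thesis unfolding CS_def mem_Collect_eq gen_permute dom_permute by (intro conjI ballI impI) blast+
qed

lemma cs_equiv_permute: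
  assumes "(\<Phi>, \<Psi>) \<in> cs_equiv d"
  shows "(permute_gens \<tau> \<Phi>, permute_gens \<tau> \<Psi>) \<in> cs_equiv d"
proof -
  obtain h L where "\<Phi> \<in> CS d" "\<Psi> \<in> CS d" "L > 0" "h ` limit_set d \<Phi> = limit_set d \<Psi>"
    "\<And>x y. x \<in> limit_set d \<Phi> \<Longrightarrow> y \<in> limit_set d \<Phi> \<Longrightarrow>
      \<bar>h x - h y\<bar> \<le> L * \<bar>x - y\<bar> \<and> \<bar>x - y\<bar> \<le> L * \<bar>h x - h y\<bar>"
    and conj: "\<And>i x. i \<in> {1..d} \<Longrightarrow> x \<in> limit_set d \<Phi> \<Longrightarrow> gen \<Psi> i (h x) = h (gen \<Phi> i x)"
    using assms by (rule cs_equivE) (rule that; assumption)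
  then show ?thesis
    by (intro cs_equivI[where h = h and L = L] permute_in_CS)
       (simp_all add: limit_set_permute conj[OF permuted_index] del: atLeastAtMost_iff)
qed

lemma has_slopes_permute: "has_slopes d \<Psi> a \<Longrightarrow> has_slopes d (permute_gens \<tau> \<Psi>) (\<lambda>i. a (\<tau> i))"
  unfolding has_slopes_def gen_permute dom_permute using permuted_index by blast

end

section \<open>Affine systems with prescribed ratios\<close>

text \<open>
  The unit interval has length \<open>1 - (\<Sum>i. s i)\<close> to spare.  It is distributed equally into \<open>d + 1\<close> gaps of length \<open>g\<close>
  before, between and after the images \<open>{b i..b i + s i}\<close>, which therefore are disjoint and lie in the interior.
\<close>

lemma affine_system_exists:
  assumes s: "\<And>i. i \<in> {1..d} \<Longrightarrow> 0 < s i" and sum: "(\<Sum>i=1..d. s i) < 1"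
  shows "\<exists>\<Psi>. affine_system d \<Psi> s"
proof -
  define g where "g = (1 - (\<Sum>i=1..d. s i)) / (real d + 1)"
  define b where "b = (\<lambda>i. (\<Sum>j=1..<i. s j) + real i * g)"
  define \<Psi> where "\<Psi> = \<lparr>dom = {0..1}, gen = \<lambda>i x. s i * x + b i\<rparr>"
  have g: "0 < g" using sum by (simp add: g_def)
  have gd: "(\<Sum>i=1..d. s i) + real d * g = 1 - g" by (simp add: g_def field_simps)
  have b_pos: "0 < b i" if "i \<in> {1..d}" for i
  proof -
    have "0 \<le> (\<Sum>j=1..<i. s j)" using s that by (intro sum_nonneg less_imp_le) auto
    then show ?thesis using g that unfolding b_def by (intro add_nonneg_pos) auto
  qed
  have b_end: "b i + s i = (\<Sum>j=1..i. s j) + real i * g" if "i \<in> {1..d}" for i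
    using that unfolding b_def by (simp add: atLeastLessThanSuc_atLeastAtMost[symmetric] sum.atLeastLessThan_Suc)
  have b_top: "b i + s i < 1" if "i \<in> {1..d}" for i
  proof -
    have "(\<Sum>j=1..i. s j) \<le> (\<Sum>j=1..d. s j)" using that s by (intro sum_mono2) (auto intro: less_imp_le)
    moreover have "real i * g \<le> real d * g" using that g by (intro mult_right_mono) auto
    ultimately show ?thesis using b_end[OF that] gd g by linarith
  qed
  have b_gap: "b i + s i < b j" if "i \<in> {1..d}" "j \<in> {1..d}" "i < j" for i j
  proof -
    have "(\<Sum>k=1..i. s k) \<le> (\<Sum>k=1..<j. s k)" using that s by (intro sum_mono2) (auto intro: less_imp_le)
    moreover have "real i * g < real j * g" using that g by simp
    ultimately show ?thesis using b_end[OF that(1)] unfolding b_def by linarith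
  qed
  have s1: "s i < 1" if "i \<in> {1..d}" for i using b_top[OF that] b_pos[OF that] by linarith
  have range: "b i \<le> s i * x + b i" "s i * x + b i \<le> b i + s i" if "i \<in> {1..d}" "x \<in> {0..1}" for i x
    using s[OF that(1)] that(2) by (simp_all add: mult_left_le)
  have disj: "(\<lambda>x. s i * x + b i) ` {0<..<1} \<inter> (\<lambda>x. s j * x + b j) ` {0<..<1} = {}"
    if ij: "i \<in> {1..d}" "j \<in> {1..d}" "i \<noteq> j" for i j
  proof -
    have False if xy: "x \<in> {0<..<1}" "y \<in> {0<..<1}" and eq: "s i * x + b i = s j * y + b j" for x y
    proof -
      have "x \<in> {0..1}" "y \<in> {0..1}" using xy by auto
      note r = range[OF ij(1) this(1)] range[OF ij(2) this(2)]
      consider "i < j" | "j < i" using ij(3) by linarith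
      then show False
        using b_gap[OF ij(1,2)] b_gap[OF ij(2,1)] r eq by cases linarith+
    qed
    then show ?thesis by blast
  qed
  \<comment> \<open>Compositions of affine maps have constant derivative, so the distortion constant is \<open>1\<close>.\<close>
  define F where "F = (\<lambda>i z. complex_of_real (s i) * z + complex_of_real (b i))"
  have F_affine: "\<exists>c. foldr F \<omega> = (\<lambda>z. complex_of_real (weight s \<omega>) * z + c)" for \<omega>
  proof (induction \<omega>)
    case (Cons i \<omega>)
    then obtain c where c: "foldr F \<omega> = (\<lambda>z. complex_of_real (weight s \<omega>) * z + c)" by blast
    have "foldr F (i # \<omega>) = (\<lambda>z. complex_of_real (weight s (i # \<omega>)) * z + (complex_of_real (s i) * c + complex_of_real (b i)))"
      unfolding foldr.simps c by (simp add: F_def fun_eq_iff algebra_simps)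
    then show ?case by blast
  qed (auto simp: fun_eq_iff intro: exI[of _ 0])
  have F_deriv: "deriv (foldr F \<omega>) z = complex_of_real (weight s \<omega>)" for \<omega> z
  proof -
    obtain c where c: "foldr F \<omega> = (\<lambda>z. complex_of_real (weight s \<omega>) * z + c)" using F_affine by blast
    show ?thesis unfolding c by (rule DERIV_imp_deriv) (auto intro!: derivative_eq_intros)
  qed
  have Fi_deriv: "deriv (F i) z = complex_of_real (s i)" for i z
    unfolding F_def by (rule DERIV_imp_deriv) (auto intro!: derivative_eq_intros)
  have bd: "conformal_bounded_distortion d \<Psi>"
    unfolding conformal_bounded_distortion_def
  proof (intro exI[of _ UNIV] exI[of _ F] conjI ballI)
    show "\<exists>C\<ge>1. \<forall>\<omega>\<in>lists {1..d}. \<forall>x\<in>UNIV. \<forall>y\<in>UNIV. cmod (deriv (foldr F \<omega>) y) \<le> C * cmod (deriv (foldr F \<omega>) x)"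
      unfolding F_deriv by (intro exI[of _ 1]) simp
    fix i assume i: "i \<in> {1..d}"
    show "F i holomorphic_on UNIV" unfolding F_def by (intro holomorphic_intros)
    show "deriv (F i) z \<noteq> 0" for z unfolding Fi_deriv using s[OF i] by simp
    show "F i (complex_of_real x) = complex_of_real (gen \<Psi> i x)" for x by (simp add: F_def \<Psi>_def)
  qed (simp_all add: convex_connected)
  have img: "gen \<Psi> i ` dom \<Psi> \<subseteq> interior (dom \<Psi>)" if "i \<in> {1..d}" for i
  proof (rule image_subsetI)
    fix x assume "x \<in> dom \<Psi>"
    then have "x \<in> {0..1}" by (simp add: \<Psi>_def)
    then have "b i \<le> s i * x + b i" "s i * x + b i \<le> b i + s i" by (rule range[OF that])+
    then show "gen \<Psi> i x \<in> interior (dom \<Psi>)" using b_pos[OF that] b_top[OF that] by (simp add: \<Psi>_def)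
  qed
  have int: "gen \<Psi> i ` interior (dom \<Psi>) \<subseteq> interior (dom \<Psi>)" if "i \<in> {1..d}" for i
    using img[OF that] interior_subset[of "dom \<Psi>"] by blast
  have inj: "inj_on (gen \<Psi> i) (dom \<Psi>)" if "i \<in> {1..d}" for i
    using s[OF that] by (simp add: \<Psi>_def inj_on_def)
  have lip: "\<exists>c<1. c-lipschitz_on (dom \<Psi>) (gen \<Psi> i)" if "i \<in> {1..d}" for i
    using s[OF that] s1[OF that]
    by (intro exI[of _ "s i"] conjI lipschitz_onI)
       (simp_all add: \<Psi>_def dist_real_def abs_mult right_diff_distrib[symmetric])
  have dj: "gen \<Psi> i ` interior (dom \<Psi>) \<inter> gen \<Psi> j ` interior (dom \<Psi>) = {}"
    if "i \<in> {1..d}" "j \<in> {1..d}" "i \<noteq> j" for i j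
    using disj[OF that] by (simp add: \<Psi>_def)
  have dm: "dom \<Psi> \<noteq> {}" "connected (dom \<Psi>)" "compact (dom \<Psi>)" by (simp_all add: \<Psi>_def)
  have "\<Psi> \<in> CS d"
    unfolding CS_def mem_Collect_eq by (intro conjI ballI impI dm bd img int inj lip dj; assumption)
  moreover have "has_slopes d \<Psi> s" unfolding has_slopes_def by (auto simp: \<Psi>_def)
  ultimately show ?thesis by (intro exI[of _ \<Psi>] affine_system.intro conformal_system.intro affine_system_axioms.intro)
qed

section \<open>Realising a Gibbs measure with prescribed pressure\<close>

lemma bernoulli_measure_inject:
  assumes p: "\<And>i. i \<in> {1..d} \<Longrightarrow> 0 \<le> p i" "(\<Sum>i=1..d. p i) = 1"
    and q: "\<And>i. i \<in> {1..d} \<Longrightarrow> 0 \<le> q i" "(\<Sum>i=1..d. q i) = 1"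
    and eq: "bernoulli_measure d p = bernoulli_measure d q" and i: "i \<in> {1..d}"
  shows "p i = q i"
proof -
  have w: "[i] \<in> lists {1..d}" using i by simp
  have "measure (bernoulli_measure d p) (sstart {1..d} [i]) = weight p [i]"
    by (rule bernoulli_measure_sstart[OF p w])
  moreover have "measure (bernoulli_measure d q) (sstart {1..d} [i]) = weight q [i]"
    by (rule bernoulli_measure_sstart[OF q w])
  ultimately show ?thesis using eq by simp
qed

theorem proposition4p8:
  fixes d :: nat and \<Phi> :: ifs and u v p :: real
  assumes "d \<ge> 2"
    and "\<Phi> \<in> EAS d"
    and "\<not> degenerate d \<Phi>"
    and "admissible d \<Phi> u v p"
  shows "\<exists>K \<in> EAS d // cs_equiv d.
           (\<forall>\<Psi>\<in>K. gibbs_iso d \<Phi> u \<Psi> v \<and> p = ifs_pressure d \<Psi> v) \<and>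
           (\<forall>\<Psi>'\<in>EAS d. gibbs_iso d \<Phi> u \<Psi>' v \<and> p = ifs_pressure d \<Psi>' v \<longrightarrow>
              (\<exists>\<tau>. \<tau> permutes {1..d} \<and> permute_gens \<tau> \<Psi>' \<in> K))"
proof -
  have d1: "d \<ge> 1" using assms(1) by simp
  have v: "v \<noteq> 0" and adm: "ifs_pressure d \<Phi> (u / v) < (ifs_pressure d \<Phi> u - p) / v"
    using assms(4) by (auto simp: admissible_def)
  have EAS_ratios: "\<exists>\<Psi>0 a. affine_system d \<Psi>0 a \<and> (\<Psi>, \<Psi>0) \<in> cs_equiv d \<and> has_ratios d \<Psi> (\<lambda>i. \<bar>a i\<bar>)"
    if "\<Psi> \<in> EAS d" for \<Psi>
  proof -
    have "\<exists>\<Psi>0\<in>AS d. (\<Psi>, \<Psi>0) \<in> cs_equiv d" using that unfolding EAS_def by simp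
    then obtain \<Psi>0 where AS: "\<Psi>0 \<in> AS d" and "(\<Psi>, \<Psi>0) \<in> cs_equiv d" by (rule bexE)
    moreover obtain a where "\<Psi>0 \<in> CS d" "has_slopes d \<Psi>0 a" using AS unfolding AS_iff_has_slopes by blast
    ultimately show ?thesis using has_ratios_of_equiv_affine[OF assms(1)]
      by (intro exI[of _ \<Psi>0] exI[of _ a] conjI affine_system.intro conformal_system.intro affine_system_axioms.intro)
  qed
  obtain a where "has_ratios d \<Phi> (\<lambda>i. \<bar>a i\<bar>)" using EAS_ratios[OF assms(2)] by blast
  then obtain r where ratios: "has_ratios d \<Phi> r" and r0: "\<And>i. 0 \<le> r i" by (metis abs_ge_zero)
  have r: "0 < r i" if "i \<in> {1..d}" for i using ratios that by (auto simp: has_ratios_def)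
  define w where "w = gibbs_weights d r u"
  have w: "0 < w i" if "i \<in> {1..d}" for i unfolding w_def by (rule gibbs_weights(1)[OF d1 r that])
  have w_sum: "(\<Sum>i=1..d. w i) = 1" unfolding w_def by (rule gibbs_weights(2)[OF d1 r])
  have w0: "0 \<le> w i" for i unfolding w_def gibbs_weights_def by (simp add: sum_nonneg)
  \<comment> \<open>The only solution of \<open>s i powr v / exp p = w i\<close>, the equation between the two Bernoulli weights.\<close>
  define s where "s = (\<lambda>i. (w i * exp p) powr (1 / v))"
  have s: "0 < s i" if "i \<in> {1..d}" for i using w[OF that] by (simp add: s_def)
  have s_powr: "s i powr v = w i * exp p" for i using v w0[of i] by (simp add: s_def powr_powr)
  \<comment> \<open>The admissibility condition enters here.\<close>
  have s_sum: "(\<Sum>i=1..d. s i) < 1"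
  proof -
    define Z where "Z = (\<Sum>i=1..d. r i powr u)"
    define Y where "Y = (\<Sum>i=1..d. r i powr (u / v))"
    have Z: "0 < Z" unfolding Z_def by (rule sum_powr_pos[of d r u, OF d1 r])
    have Y: "0 < Y" unfolding Y_def by (rule sum_powr_pos[of d r "u / v", OF d1 r])
    have P: "ifs_pressure d \<Phi> u = ln Z" "ifs_pressure d \<Phi> (u / v) = ln Y"
      unfolding Z_def Y_def by (rule ifs_pressure_eq[OF d1 ratios])+
    have "s i = r i powr (u / v) * exp ((p - ln Z) / v)" for i
    proof -
      have "w i * exp p = r i powr u * exp (p - ln Z)"
        using Z by (simp add: w_def gibbs_weights_def Z_def exp_diff)
      then have "s i = (r i powr u) powr (1 / v) * exp (p - ln Z) powr (1 / v)"
        unfolding s_def by (simp add: powr_mult)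
      then show ?thesis by (simp add: powr_powr powr_def)
    qed
    then have "(\<Sum>i=1..d. s i) = exp (ln Y) * exp ((p - ln Z) / v)"
      using Y by (simp add: sum_distrib_right[symmetric] Y_def)
    also have "\<dots> = exp (ln Y - (ln Z - p) / v)" by (simp add: exp_add[symmetric] diff_divide_distrib)
    also have "\<dots> < 1" using adm unfolding P by simp
    finally show ?thesis .
  qed
  obtain \<Psi>0 where \<Psi>0: "affine_system d \<Psi>0 s" using affine_system_exists[OF s s_sum] by blast
  interpret A: affine_system d \<Psi>0 s by (rule \<Psi>0)
  define K where "K = cs_equiv d `` {\<Psi>0}"
  have "\<Psi>0 \<in> EAS d"
  proof -
    have "\<Psi>0 \<in> AS d" unfolding AS_iff_has_slopes using A.in_CS A.slopes by blast
    then show ?thesis unfolding EAS_def using A.in_CS cs_equiv_refl[OF A.in_CS] by blast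
  qed
  then have K: "K \<in> EAS d // cs_equiv d" unfolding K_def by (rule quotientI)
  have Phi_gibbs: "gibbs_measure d \<Phi> u = bernoulli_measure d w"
    unfolding w_def by (rule gibbs_measure_eq_bernoulli[OF d1 ratios])
  have "gibbs_iso d \<Phi> u \<Psi> v \<and> p = ifs_pressure d \<Psi> v" if "\<Psi> \<in> K" for \<Psi>
  proof -
    have "(\<Psi>, \<Psi>0) \<in> cs_equiv d" using that unfolding K_def by (simp add: cs_equiv_sym)
    then have "has_ratios d \<Psi> (\<lambda>i. \<bar>s i\<bar>)" by (rule has_ratios_of_equiv_affine[OF assms(1) _ A.slopes])
    then have ratios': "has_ratios d \<Psi> s" by (simp add: s_def)
    have sum_s: "(\<Sum>i=1..d. s i powr v) = exp p"
      unfolding s_powr sum_distrib_right[symmetric] w_sum by simp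
    then have "gibbs_weights d s v = w" by (simp add: gibbs_weights_def fun_eq_iff s_powr)
    then have "gibbs_measure d \<Psi> v = bernoulli_measure d w"
      using gibbs_measure_eq_bernoulli[OF d1 ratios', of v] by simp
    then have "gibbs_iso d \<Phi> u \<Psi> v"
      unfolding gibbs_iso_def Phi_gibbs by (intro exI[of _ id]) (simp add: permutes_id permute_gens_def)
    moreover have "ifs_pressure d \<Psi> v = p" unfolding ifs_pressure_eq[OF d1 ratios'] sum_s by simp
    ultimately show ?thesis by simp
  qed
  moreover have "\<exists>\<tau>. \<tau> permutes {1..d} \<and> permute_gens \<tau> \<Psi>' \<in> K"
    if \<Psi>': "\<Psi>' \<in> EAS d" and iso: "gibbs_iso d \<Phi> u \<Psi>' v" and p: "p = ifs_pressure d \<Psi>' v" for \<Psi>'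
  proof -
    \<comment> \<open>After the permutation, equality of the Bernoulli weights determines the ratios.\<close>
    obtain \<tau> where \<tau>: "\<tau> permutes {1..d}"
      and gibbs: "gibbs_measure d \<Phi> u = gibbs_measure d (permute_gens \<tau> \<Psi>') v"
      using iso unfolding gibbs_iso_def by blast
    obtain \<Psi>1 b where \<Psi>1: "affine_system d \<Psi>1 b" and equiv: "(\<Psi>', \<Psi>1) \<in> cs_equiv d"
      and ratios1: "has_ratios d \<Psi>' (\<lambda>i. \<bar>b i\<bar>)" using EAS_ratios[OF \<Psi>'] by blast
    interpret B: affine_system d \<Psi>1 b by (rule \<Psi>1)
    define t where "t = (\<lambda>i. \<bar>b (\<tau> i)\<bar>)"
    have equiv\<tau>: "(permute_gens \<tau> \<Psi>', permute_gens \<tau> \<Psi>1) \<in> cs_equiv d" by (rule cs_equiv_permute[OF \<tau> equiv])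
    have slopes\<tau>: "has_slopes d (permute_gens \<tau> \<Psi>1) (\<lambda>i. b (\<tau> i))" by (rule has_slopes_permute[OF \<tau> B.slopes])
    have ratios\<tau>: "has_ratios d (permute_gens \<tau> \<Psi>') t"
      unfolding t_def by (rule has_ratios_of_equiv_affine[OF assms(1) equiv\<tau> slopes\<tau>])
    have t: "0 < t i" if "i \<in> {1..d}" for i using ratios\<tau> that by (auto simp: has_ratios_def)
    have b: "0 < \<bar>b i\<bar>" if "i \<in> {1..d}" for i using B.slope_nonzero[OF that] by simp
    have "exp p = (\<Sum>i=1..d. \<bar>b i\<bar> powr v)"
      unfolding p ifs_pressure_eq[OF d1 ratios1] using sum_powr_pos[of d "\<lambda>i. \<bar>b i\<bar>" v, OF d1 b] by simp
    also have "\<dots> = (\<Sum>i=1..d. t i powr v)"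
      unfolding t_def by (rule sum.permute[OF \<tau>, unfolded o_def])
    finally have t_sum: "(\<Sum>i=1..d. t i powr v) = exp p" ..
    have beq: "bernoulli_measure d (gibbs_weights d t v) = bernoulli_measure d w"
      using gibbs Phi_gibbs gibbs_measure_eq_bernoulli[OF d1 ratios\<tau>, of v] by simp
    have "gibbs_weights d t v i = w i" if "i \<in> {1..d}" for i
    proof (rule bernoulli_measure_inject[OF _ _ w0 w_sum beq that])
      show "0 \<le> gibbs_weights d t v j" if "j \<in> {1..d}" for j
        using gibbs_weights(1)[of d t j v, OF d1 t that] by simp
      show "(\<Sum>i=1..d. gibbs_weights d t v i) = 1" by (rule gibbs_weights(2)[of d t, OF d1 t])
    qed
    then have t_powr: "t i powr v = s i powr v" if "i \<in> {1..d}" for i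
      using that unfolding s_powr gibbs_weights_def t_sum by (simp add: field_simps)
    have "t i = s i" if i: "i \<in> {1..d}" for i
    proof -
      have "(t i powr v) powr (1 / v) = (s i powr v) powr (1 / v)" by (simp only: t_powr[OF i])
      then show ?thesis using v t[OF i] s[OF i] by (simp add: powr_powr)
    qed
    then have abs_eq: "\<bar>s i\<bar> = \<bar>b (\<tau> i)\<bar>" if "i \<in> {1..d}" for i
      using that s[OF that] unfolding t_def by (metis abs_of_pos)
    have "affine_system d (permute_gens \<tau> \<Psi>1) (\<lambda>i. b (\<tau> i))"
      using permute_in_CS[OF \<tau> B.in_CS] slopes\<tau>
      by (intro affine_system.intro conformal_system.intro affine_system_axioms.intro)
    then have "(\<Psi>0, permute_gens \<tau> \<Psi>1) \<in> cs_equiv d" by (rule affine_equal_ratios_equiv[OF \<Psi>0 _ abs_eq])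
    then have "(\<Psi>0, permute_gens \<tau> \<Psi>') \<in> cs_equiv d" by (rule cs_equiv_trans[OF _ cs_equiv_sym[OF equiv\<tau>]])
    then show ?thesis using \<tau> unfolding K_def by blast
  qed
  ultimately show ?thesis using K by blast
qed

end
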